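(* Let $m,l\in\mathbb{R}$. With respect to the orthonormal frame $(X_1,\dots,X_7)$, the matrix $\big(\mathrm{Ric}(X_\alpha,X_\beta)\big)_{1\le\alpha,\beta\le 7}$ representing the Ricci tensor of the extended Bianchi-Cartan-Vranceanu space $(EBCV,\mathrm{ds}^2_{m,l})$ is the symmetric matrix $$\begin{pmatrix} V & M\\ M^{T} & H\end{pmatrix},$$ where, with $A=-l^2(K+1)$ and $B=12m-\tfrac{3}{2}l^2$, $$V=\tfrac{l^2}{2}(K^2+1)\begin{pmatrix}1&0&0\\0&1&0\\0&0&1\end{pmatrix},$$ $$M=ml(K+2)\begin{pmatrix}-x&w&-z&y\\-y&z&w&-x\\-z&-y&x&w\end{pmatrix},$$ $$H=\begin{pmatrix} A(K-1-mw^2)+B& ml^2(K+1)wx& ml^2(K+1)wy& ml^2(K+1)wz\\ ml^2(K+1)wx& A(K-1-mx^2)+B& ml^2(K+1)xy& ml^2(K+1)xz\\ ml^2(K+1)wy& ml^2(K+1)xy& A(K-1-my^2)+B& ml^2(K+1)yz\\ ml^2(K+1)wz& ml^2(K+1)xz& ml^2(K+1)yz& A(K-1-mz^2)+B \end{pmatrix}.$$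
   Context: For real numbers $m,l$, use coordinates $(w,x,y,z,r,s,t)$ on $\mathbb{R}^7$ and put $K=1+m(w^2+x^2+y^2+z^2)$. The extended Bianchi-Cartan-Vranceanu space $EBCV$ is the set $\{(w,x,y,z,r,s,t)\in\mathbb{R}^7: K>0\}$ with the Riemannian metric $$\mathrm{ds}^2_{m,l}=\frac{dw^2+dx^2+dy^2+dz^2}{K^2}+\Big(dr+\tfrac{l}{2}\tfrac{w\,dx-x\,dw+y\,dz-z\,dy}{K}\Big)^2+\Big(ds+\tfrac{l}{2}\tfrac{w\,dy-y\,dw+z\,dx-x\,dz}{K}\Big)^2+\Big(dt+\tfrac{l}{2}\tfrac{w\,dz-z\,dw+x\,dy-y\,dx}{K}\Big)^2 .$$ An orthonormal frame is $X_1=\partial_r$, $X_2=\partial_s$, $X_3=\partial_t$, $X_4=K\partial_w+\frac{lx}{2}\partial_r+\frac{ly}{2}\partial_s+\frac{lz}{2}\partial_t$, $X_5=K\partial_x-\frac{lw}{2}\partial_r-\frac{lz}{2}\partial_s+\frac{ly}{2}\partial_t$, $X_6=K\partial_y+\frac{lz}{2}\partial_r-\frac{lw}{2}\partial_s-\frac{lx}{2}\partial_t$, $X_7=K\partial_z-\frac{ly}{2}\partial_r+\frac{lx}{2}\partial_s-\frac{lw}{2}\partial_t$. The Ricci tensor has the usual sign convention: for a unit vector $u$, $\mathrm{Ric}(u,u)$ is the sum of the sectional curvatures of the planes spanned by $u$ and the other members of an orthonormal basis containing $u$ (so round spheres have positive Ricci curvature). *)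

theory Defs
  imports "HOL-Analysis.Analysis"
begin

section \<open>Curvature of a metric in global coordinates\<close>

text \<open>
  A metric on an open subset of \<open>real^'n\<close> is a function \<open>g\<close> that takes a point \<open>p\<close> and two
  tangent vectors at \<open>p\<close>, given by their components in the coordinate basis \<open>axis i 1\<close>.  All
  notions below only depend on the values of \<open>g\<close> near the point \<open>p\<close>.
\<close>

type_synonym 'n metric = "real^'n \<Rightarrow> real^'n \<Rightarrow> real^'n \<Rightarrow> real"

definition partial_deriv :: "'n \<Rightarrow> (real^'n \<Rightarrow> real) \<Rightarrow> real^'n \<Rightarrow> real" where
  "partial_deriv i f p = deriv (\<lambda>t. f (p + t *\<^sub>R axis i 1)) 0"

definition metric_coeff :: "'n::finite metric \<Rightarrow> real^'n \<Rightarrow> real^'n^'n" where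
  "metric_coeff g p = (\<chi> i j. g p (axis i 1) (axis j 1))"

text \<open>\<open>christoffel g k i j\<close> has the upper index \<open>k\<close> and the lower indices \<open>i\<close>, \<open>j\<close>.\<close>

definition christoffel :: "'n::finite metric \<Rightarrow> 'n \<Rightarrow> 'n \<Rightarrow> 'n \<Rightarrow> real^'n \<Rightarrow> real" where
  "christoffel g k i j p =
     (1/2) * (\<Sum>q\<in>UNIV. matrix_inv (metric_coeff g p) $ k $ q *
        (partial_deriv i (\<lambda>x. metric_coeff g x $ j $ q) p
         + partial_deriv j (\<lambda>x. metric_coeff g x $ i $ q) p
         - partial_deriv q (\<lambda>x. metric_coeff g x $ i $ j) p))"

text \<open>
  The \<open>k\<close>-th component of \<open>R(\<partial>\<^sub>a, \<partial>\<^sub>b) \<partial>\<^sub>c\<close>, where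
  \<open>R(X, Y) Z = \<nabla>\<^sub>X \<nabla>\<^sub>Y Z - \<nabla>\<^sub>Y \<nabla>\<^sub>X Z - \<nabla>\<^bsub>[X,Y]\<^esub> Z\<close>.
\<close>

definition riemann_coeff ::
    "'n::finite metric \<Rightarrow> 'n \<Rightarrow> 'n \<Rightarrow> 'n \<Rightarrow> 'n \<Rightarrow> real^'n \<Rightarrow> real" where
  "riemann_coeff g k a b c p =
     partial_deriv a (christoffel g k b c) p - partial_deriv b (christoffel g k a c) p
     + (\<Sum>q\<in>UNIV. christoffel g k a q p * christoffel g q b c p
                - christoffel g k b q p * christoffel g q a c p)"

definition curvature ::
    "'n::finite metric \<Rightarrow> real^'n \<Rightarrow> real^'n \<Rightarrow> real^'n \<Rightarrow> real^'n \<Rightarrow> real^'n" where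
  "curvature g p u v z =
     (\<chi> k. \<Sum>a\<in>UNIV. \<Sum>b\<in>UNIV. \<Sum>c\<in>UNIV. riemann_coeff g k a b c p * u $ a * v $ b * z $ c)"

text \<open>
  The trace of \<open>z \<mapsto> R(z, u) v\<close>.  For an orthonormal basis \<open>e\<^sub>1, \<dots>, e\<^sub>n\<close> with \<open>u = e\<^sub>1\<close> this gives
  \<open>Ric(u, u) = \<Sum>\<^sub>i g(R(e\<^sub>i, u) u, e\<^sub>i)\<close>, the sum of the sectional curvatures of the planes spanned
  by \<open>u\<close> and \<open>e\<^sub>i\<close> for \<open>i \<noteq> 1\<close>.
\<close>

definition ricci :: "'n::finite metric \<Rightarrow> real^'n \<Rightarrow> real^'n \<Rightarrow> real^'n \<Rightarrow> real" where
  "ricci g p u v = trace (matrix (\<lambda>z. curvature g p z u v))"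


section \<open>The extended Bianchi-Cartan-Vranceanu space\<close>

text \<open>
  The coordinates \<open>(w, x, y, z, r, s, t)\<close> of \<open>p\<close> are \<open>p $ 1, \<dots>, p $ 7\<close>.  In the index type
  \<open>7\<close> the numeral \<open>7\<close> equals \<open>0\<close>; \<open>vector [a\<^sub>1, \<dots>, a\<^sub>7]\<close> has the component
  \<open>a\<^sub>i\<close> at the index \<open>i\<close>, and likewise for the index types \<open>3\<close> and \<open>4\<close>.
\<close>

definition ebcv_K :: "real \<Rightarrow> real^7 \<Rightarrow> real" where
  "ebcv_K m p = 1 + m * ((p $ 1)\<^sup>2 + (p $ 2)\<^sup>2 + (p $ 3)\<^sup>2 + (p $ 4)\<^sup>2)"

definition EBCV :: "real \<Rightarrow> (real^7) set" where
  "EBCV m = {p. ebcv_K m p > 0}"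

text \<open>
  The three one-forms \<open>dr + \<dots>\<close>, \<open>ds + \<dots>\<close>, \<open>dt + \<dots>\<close> whose squares occur in the metric,
  evaluated on the tangent vector \<open>v = (dw, dx, dy, dz, dr, ds, dt)\<close>.
\<close>

definition ebcv_form :: "real \<Rightarrow> real \<Rightarrow> real^7 \<Rightarrow> real^7 \<Rightarrow> real^3" where
  "ebcv_form m l p v =
    (let K = ebcv_K m p;
         w = p $ 1; x = p $ 2; y = p $ 3; z = p $ 4;
         dw = v $ 1; dx = v $ 2; dy = v $ 3; dz = v $ 4; dr = v $ 5; ds = v $ 6; dt = v $ 7
     in vector
       [dr + l/2 * ((w * dx - x * dw + y * dz - z * dy) / K),
        ds + l/2 * ((w * dy - y * dw + z * dx - x * dz) / K),
        dt + l/2 * ((w * dz - z * dw + x * dy - y * dx) / K)])"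

text \<open>The symmetric bilinear form whose quadratic form is \<open>ds\<^sup>2\<close>.\<close>

definition ebcv_metric :: "real \<Rightarrow> real \<Rightarrow> 7 metric" where
  "ebcv_metric m l p u v =
     (u $ 1 * v $ 1 + u $ 2 * v $ 2 + u $ 3 * v $ 3 + u $ 4 * v $ 4) / (ebcv_K m p)\<^sup>2
     + ebcv_form m l p u $ 1 * ebcv_form m l p v $ 1
     + ebcv_form m l p u $ 2 * ebcv_form m l p v $ 2
     + ebcv_form m l p u $ 3 * ebcv_form m l p v $ 3"

text \<open>The vector field \<open>X\<^sub>\<alpha>\<close> at \<open>p\<close> is \<open>ebcv_frame m l p $ \<alpha>\<close>.\<close>

definition ebcv_frame :: "real \<Rightarrow> real \<Rightarrow> real^7 \<Rightarrow> real^7^7" where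
  "ebcv_frame m l p =
    (let K = ebcv_K m p; w = p $ 1; x = p $ 2; y = p $ 3; z = p $ 4
     in vector
       [vector [0, 0, 0, 0, 1, 0, 0],
        vector [0, 0, 0, 0, 0, 1, 0],
        vector [0, 0, 0, 0, 0, 0, 1],
        vector [K, 0, 0, 0,   l*x/2,    l*y/2,    l*z/2],
        vector [0, K, 0, 0, - (l*w/2), - (l*z/2),   l*y/2],
        vector [0, 0, K, 0,   l*z/2,  - (l*w/2), - (l*x/2)],
        vector [0, 0, 0, K, - (l*y/2),   l*x/2,  - (l*w/2)]])"

lemma UNIV_7: "(UNIV :: 7 set) = {1, 2, 3, 4, 5, 6, 7}"
proof -
  have "a \<in> {1, 2, 3, 4, 5, 6, 7}" for a :: 7
  proof (induct a)
    case (of_int z)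
    then have "z = 0 \<or> z = 1 \<or> z = 2 \<or> z = 3 \<or> z = 4 \<or> z = 5 \<or> z = 6"
      by fastforce
    then show ?case
      by auto
  qed
  then show ?thesis
    by blast
qed

lemma forall_7: "(\<forall>i::7. P i) \<longleftrightarrow> P 1 \<and> P 2 \<and> P 3 \<and> P 4 \<and> P 5 \<and> P 6 \<and> P 7"
  using UNIV_7 by (metis UNIV_I empty_iff insertE)

lemma vector_7 [simp]:
  fixes a b c d e f g :: "'a::zero"
  shows "(vector [a, b, c, d, e, f, g] :: 'a^7) $ 1 = a"
    and "(vector [a, b, c, d, e, f, g] :: 'a^7) $ 2 = b"
    and "(vector [a, b, c, d, e, f, g] :: 'a^7) $ 3 = c"
    and "(vector [a, b, c, d, e, f, g] :: 'a^7) $ 4 = d"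
    and "(vector [a, b, c, d, e, f, g] :: 'a^7) $ 5 = e"
    and "(vector [a, b, c, d, e, f, g] :: 'a^7) $ 6 = f"
    and "(vector [a, b, c, d, e, f, g] :: 'a^7) $ 7 = g"
  by (simp_all add: vector_def)

lemma ebcv_frame_orthonormal:
  assumes "p \<in> EBCV m"
  shows "ebcv_metric m l p (ebcv_frame m l p $ \<alpha>) (ebcv_frame m l p $ \<beta>) = (if \<alpha> = \<beta> then 1 else 0)"
proof -
  have "ebcv_K m p \<noteq> 0"
    using assms by (simp add: EBCV_def)
  then have "\<forall>\<alpha> \<beta>. ebcv_metric m l p (ebcv_frame m l p $ \<alpha>) (ebcv_frame m l p $ \<beta>) =
      (if \<alpha> = \<beta> then 1 else 0)"
    by (simp add: forall_7 ebcv_metric_def ebcv_form_def ebcv_frame_def Let_def power2_eq_square)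
  then show ?thesis
    by blast
qed

definition ebcv_V :: "real \<Rightarrow> real \<Rightarrow> real^7 \<Rightarrow> real^3^3" where
  "ebcv_V m l p = (l\<^sup>2 / 2 * ((ebcv_K m p)\<^sup>2 + 1)) *\<^sub>R mat 1"

definition ebcv_M :: "real \<Rightarrow> real \<Rightarrow> real^7 \<Rightarrow> real^4^3" where
  "ebcv_M m l p =
    (let K = ebcv_K m p; w = p $ 1; x = p $ 2; y = p $ 3; z = p $ 4
     in (m * l * (K + 2)) *\<^sub>R vector
       [vector [- x,   w, - z,   y],
        vector [- y,   z,   w, - x],
        vector [- z, - y,   x,   w]])"

definition ebcv_H :: "real \<Rightarrow> real \<Rightarrow> real^7 \<Rightarrow> real^4^4" where
  "ebcv_H m l p =
    (let K = ebcv_K m p; w = p $ 1; x = p $ 2; y = p $ 3; z = p $ 4;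
         A = - (l\<^sup>2) * (K + 1); B = 12 * m - 3/2 * l\<^sup>2; C = m * l\<^sup>2 * (K + 1)
     in vector
       [vector [A * (K - 1 - m * w\<^sup>2) + B, C * w * x, C * w * y, C * w * z],
        vector [C * w * x, A * (K - 1 - m * x\<^sup>2) + B, C * x * y, C * x * z],
        vector [C * w * y, C * x * y, A * (K - 1 - m * y\<^sup>2) + B, C * y * z],
        vector [C * w * z, C * x * z, C * y * z, A * (K - 1 - m * z\<^sup>2) + B]])"

definition block_matrix ::
    "real^3^3 \<Rightarrow> real^4^3 \<Rightarrow> real^3^4 \<Rightarrow> real^4^4 \<Rightarrow> real^7^7" where
  "block_matrix P Q R S =
    (let upper = (\<lambda>i. vector [P$i$1, P$i$2, P$i$3, Q$i$1, Q$i$2, Q$i$3, Q$i$4]);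
         lower = (\<lambda>i. vector [R$i$1, R$i$2, R$i$3, S$i$1, S$i$2, S$i$3, S$i$4])
     in vector [upper 1, upper 2, upper 3, lower 1, lower 2, lower 3, lower 4])"

end

theory Submission
  imports Defs
begin

text \<open>
  The metric has Kaluza-Klein form.  Write \<open>\<theta>\<^sup>1, \<theta>\<^sup>2, \<theta>\<^sup>3\<close> for the one-forms whose squares occur
  in it; then \<open>\<theta>\<^sup>a\<close> is the differential of a fibre coordinate plus a one-form \<open>A\<^sup>a\<close> on the base, the
  base carries the conformally flat metric \<open>(dw\<^sup>2 + dx\<^sup>2 + dy\<^sup>2 + dz\<^sup>2) / K\<^sup>2\<close> of constant curvature
  \<open>4m\<close>, and nothing depends on the fibre coordinates.  The Ricci tensor is therefore governed by the
  curvature of the base and by the two-forms \<open>F\<^sup>a = d\<theta>\<^sup>a = dA\<^sup>a\<close>.  With \<open>a, b\<close> for the fibre directions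
  \<open>X\<^sub>1, X\<^sub>2, X\<^sub>3\<close> and \<open>i, j, k\<close> for the base directions \<open>X\<^sub>4, \<dots>, X\<^sub>7\<close>,
  \<open>Ric(X\<^sub>a, X\<^sub>b) = 1/4 \<Sum>\<^sub>i\<^sub>j F\<^sup>a\<^sub>i\<^sub>j F\<^sup>b\<^sub>i\<^sub>j\<close>,
  \<open>Ric(X\<^sub>i, X\<^sub>j) = 12m \<delta>\<^sub>i\<^sub>j - 1/2 \<Sum>\<^sub>a\<^sub>k F\<^sup>a\<^sub>i\<^sub>k F\<^sup>a\<^sub>j\<^sub>k\<close>, and \<open>Ric(X\<^sub>a, X\<^sub>i)\<close> is half the divergence of
  \<open>F\<^sup>a\<close> (lemmas \<open>ricci_vert_vert\<close>, \<open>ricci_hor_hor\<close>, \<open>ricci_vert_hor\<close>).  The forms \<open>A\<^sup>a\<close> come from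
  multiplication by the quaternion units, so \<open>F\<^sup>a\<close> is an explicit polynomial, and the relation
  \<open>K - 1 = m (w\<^sup>2 + x\<^sup>2 + y\<^sup>2 + z\<^sup>2)\<close> turns these sums into the entries of the matrix.

  The Ricci tensor is defined through Christoffel symbols, which here are unwieldy rational functions of the
  coordinates.  In the orthonormal frame the brackets have polynomial coefficients, and the Koszul
  formula expresses the connection by them.  The lemma \<open>ricci_frame\<close> makes this passage for an arbitrary
  orthonormal frame.  It rests on two facts: a torsion-free connection that preserves the metric
  has the Christoffel symbols as its coefficients (\<open>christoffel_unique\<close>), and under a change from
  the coordinate basis to a frame the curvature changes by conjugation (\<open>curvature_gauge\<close>).
\<close>

section \<open>Partial and directional derivatives\<close>

lemma partial_deriv_eq:
  fixes f :: "real^'n::finite \<Rightarrow> real"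
  assumes "(f has_derivative D) (at p)"
  shows "partial_deriv i f p = D (axis i 1)"
proof -
  have "((\<lambda>t::real. p + t *\<^sub>R axis i 1) has_derivative (\<lambda>t. t *\<^sub>R axis i 1)) (at 0)"
    by (auto intro!: derivative_eq_intros)
  moreover have "(f has_derivative D) (at (p + 0 *\<^sub>R axis i 1))"
    using assms by simp
  ultimately have "((\<lambda>t. f (p + t *\<^sub>R axis i 1)) has_derivative (\<lambda>t. D (t *\<^sub>R axis i 1))) (at 0)"
    by (rule has_derivative_compose)
  moreover have "(\<lambda>t. D (t *\<^sub>R axis i 1)) = (*) (D (axis i 1))"
    using has_derivative_linear [OF assms] by (auto simp: linear_cmul)
  ultimately show ?thesis
    unfolding partial_deriv_def by (simp add: has_field_derivative_def DERIV_imp_deriv)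
qed

lemma partial_deriv_frechet:
  fixes f :: "real^'n::finite \<Rightarrow> real"
  assumes "f differentiable (at p)"
  shows "partial_deriv i f p = frechet_derivative f (at p) (axis i 1)"
  using assms frechet_derivative_works partial_deriv_eq by blast

lemma partial_deriv_local:
  fixes f :: "real^'n::finite \<Rightarrow> real"
  assumes "open S" "p \<in> S" "\<And>x. x \<in> S \<Longrightarrow> f x = g x" "f differentiable (at p)"
  shows "partial_deriv i g p = partial_deriv i f p"
proof -
  obtain D where D: "(f has_derivative D) (at p)"
    using assms(4) by (auto simp: differentiable_def)
  then have "(g has_derivative D) (at p)"
    using has_derivative_transform_within_open [OF D assms(1,2,3)] by blast
  with D show ?thesis
    by (simp add: partial_deriv_eq)
qed

lemma partial_deriv_const [simp]: "partial_deriv i (\<lambda>x. c) p = 0"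
  by (simp add: partial_deriv_def)

lemma partial_deriv_add:
  fixes f g :: "real^'n::finite \<Rightarrow> real"
  assumes "f differentiable (at p)" "g differentiable (at p)"
  shows "partial_deriv i (\<lambda>x. f x + g x) p = partial_deriv i f p + partial_deriv i g p"
proof -
  obtain D D' where D: "(f has_derivative D) (at p)" "(g has_derivative D') (at p)"
    using assms by (auto simp: differentiable_def)
  show ?thesis
    using partial_deriv_eq [OF has_derivative_add [OF D]]
    by (simp add: partial_deriv_eq [OF D(1)] partial_deriv_eq [OF D(2)])
qed

lemma partial_deriv_diff:
  fixes f g :: "real^'n::finite \<Rightarrow> real"
  assumes "f differentiable (at p)" "g differentiable (at p)"
  shows "partial_deriv i (\<lambda>x. f x - g x) p = partial_deriv i f p - partial_deriv i g p"
proof -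
  obtain D D' where D: "(f has_derivative D) (at p)" "(g has_derivative D') (at p)"
    using assms by (auto simp: differentiable_def)
  show ?thesis
    using partial_deriv_eq [OF has_derivative_diff [OF D]]
    by (simp add: partial_deriv_eq [OF D(1)] partial_deriv_eq [OF D(2)])
qed

lemma partial_deriv_mult:
  fixes f g :: "real^'n::finite \<Rightarrow> real"
  assumes "f differentiable (at p)" "g differentiable (at p)"
  shows "partial_deriv i (\<lambda>x. f x * g x) p = partial_deriv i f p * g p + f p * partial_deriv i g p"
proof -
  obtain D D' where D: "(f has_derivative D) (at p)" "(g has_derivative D') (at p)"
    using assms by (auto simp: differentiable_def)
  then have "((\<lambda>x. f x * g x) has_derivative (\<lambda>h. f p * D' h + D h * g p)) (at p)"
    by (rule has_derivative_mult)
  then show ?thesis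
    by (simp add: partial_deriv_eq [OF D(1)] partial_deriv_eq [OF D(2)] partial_deriv_eq)
qed

lemma partial_deriv_sum:
  fixes f :: "'a \<Rightarrow> real^'n::finite \<Rightarrow> real"
  assumes "\<And>a. a \<in> A \<Longrightarrow> f a differentiable (at p)"
  shows "partial_deriv i (\<lambda>x. \<Sum>a\<in>A. f a x) p = (\<Sum>a\<in>A. partial_deriv i (f a) p)"
proof -
  have "((\<lambda>x. \<Sum>a\<in>A. f a x) has_derivative
      (\<lambda>h. \<Sum>a\<in>A. frechet_derivative (f a) (at p) h)) (at p)"
    using assms frechet_derivative_works by (intro has_derivative_sum) blast
  from partial_deriv_eq [OF this] show ?thesis
    using assms by (simp add: partial_deriv_frechet)
qed

definition dir_deriv :: "real^'n::finite \<Rightarrow> (real^'n \<Rightarrow> real) \<Rightarrow> real^'n \<Rightarrow> real" where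
  "dir_deriv v f p = (\<Sum>i\<in>UNIV. v $ i * partial_deriv i f p)"

lemma dir_deriv_eq:
  assumes "(f has_derivative D) (at p)"
  shows "dir_deriv v f p = D v"
proof -
  interpret D: linear D
    using assms by (rule has_derivative_linear)
  have "D v = D (\<Sum>i\<in>UNIV. v $ i *\<^sub>R axis i 1)"
    using basis_expansion [of v] by (simp add: scalar_mult_eq_scaleR)
  then show ?thesis
    by (simp add: dir_deriv_def partial_deriv_eq [OF assms] D.sum D.scale)
qed

lemma dir_deriv_const [simp]: "dir_deriv v (\<lambda>x. c) p = 0"
  by (simp add: dir_deriv_def)

lemma dir_deriv_coord [simp]: "dir_deriv v (\<lambda>x. x $ i) p = v $ i"
  by (rule dir_deriv_eq) (intro bounded_linear_imp_has_derivative bounded_linear_vec_nth)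

lemma dir_deriv_diff:
  assumes "f differentiable (at p)" "g differentiable (at p)"
  shows "dir_deriv v (\<lambda>x. f x - g x) p = dir_deriv v f p - dir_deriv v g p"
  by (simp add: dir_deriv_def partial_deriv_diff [OF assms] right_diff_distrib sum_subtractf)

lemma dir_deriv_mult:
  assumes "f differentiable (at p)" "g differentiable (at p)"
  shows "dir_deriv v (\<lambda>x. f x * g x) p = dir_deriv v f p * g p + f p * dir_deriv v g p"
  by (simp add: dir_deriv_def partial_deriv_mult [OF assms] sum.distrib sum_distrib_left
      sum_distrib_right algebra_simps)

lemma dir_deriv_cmult:
  assumes "f differentiable (at p)"
  shows "dir_deriv v (\<lambda>x. c * f x) p = c * dir_deriv v f p"
  using dir_deriv_mult [of "\<lambda>x. c" p f v] assms by simp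

lemma dir_deriv_uminus:
  assumes "f differentiable (at p)"
  shows "dir_deriv v (\<lambda>x. - f x) p = - dir_deriv v f p"
  using dir_deriv_cmult [OF assms, of v "-1"] by simp

lemma differentiable_coord [simp]: "(\<lambda>x::real^'n. x $ i) differentiable F"
  by (simp add: bounded_linear_imp_differentiable bounded_linear_vec_nth)

lemma dir_deriv_add:
  assumes "f differentiable (at p)" "g differentiable (at p)"
  shows "dir_deriv v (\<lambda>x. f x + g x) p = dir_deriv v f p + dir_deriv v g p"
  by (simp add: dir_deriv_def partial_deriv_add [OF assms] distrib_left sum.distrib)

lemma dir_deriv_cdivide:
  assumes "f differentiable (at p)"
  shows "dir_deriv v (\<lambda>x. f x / c) p = dir_deriv v f p / c"
  using dir_deriv_cmult [OF assms, of v "1 / c"] by simp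

lemma real_polynomial_coord: "real_polynomial_function (\<lambda>x::real^'n. x $ i)"
  by (simp add: real_polynomial_function.intros(1) bounded_linear_vec_nth)

lemma real_polynomial_partial_deriv:
  fixes f :: "real^'n::finite \<Rightarrow> real"
  assumes "real_polynomial_function f"
  shows "real_polynomial_function (partial_deriv i f)"
  using assms
proof induction
  case (linear f)
  then have "partial_deriv i f = (\<lambda>x. f (axis i 1))"
    using bounded_linear.has_derivative [OF linear has_derivative_ident] partial_deriv_eq by fastforce
  then show ?case
    by auto
next
  case (const c)
  have "partial_deriv i (\<lambda>x. c) = (\<lambda>x. 0)"
    by auto
  then show ?case
    by auto
next
  case (add f g)
  then have "partial_deriv i (\<lambda>x. f x + g x) = (\<lambda>x. partial_deriv i f x + partial_deriv i g x)"
    by (auto simp: partial_deriv_add differentiable_at_real_polynomial_function)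
  with add show ?case
    by auto
next
  case (mult f g)
  then have "partial_deriv i (\<lambda>x. f x * g x) = (\<lambda>x. partial_deriv i f x * g x + f x * partial_deriv i g x)"
    by (auto simp: partial_deriv_mult differentiable_at_real_polynomial_function)
  with mult show ?case
    by auto
qed

text \<open>
  The curvature of a frame involves mixed second derivatives of its entries.  The entries of the EBCV frame
  are polynomials, for which the symmetry of these derivatives passes through sums and products.
\<close>

lemma real_polynomial_partial_deriv_commute:
  fixes f :: "real^'n::finite \<Rightarrow> real"
  assumes "real_polynomial_function f"
  shows "partial_deriv i (partial_deriv j f) p = partial_deriv j (partial_deriv i f) p"
  using assms
proof induction
  case (linear f)
  have "partial_deriv i f = (\<lambda>x. f (axis i 1))" for i
    using bounded_linear.has_derivative [OF linear has_derivative_ident] partial_deriv_eq by fastforce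
  then show ?case
    by simp
next
  case (const c)
  have "partial_deriv i (\<lambda>x. c) = (\<lambda>x. 0)" for i :: 'n
    by auto
  then show ?case
    by simp
next
  case (add f g)
  note diff = differentiable_at_real_polynomial_function [OF add.hyps(1)]
    differentiable_at_real_polynomial_function [OF add.hyps(2)]
    differentiable_at_real_polynomial_function [OF real_polynomial_partial_deriv [OF add.hyps(1)]]
    differentiable_at_real_polynomial_function [OF real_polynomial_partial_deriv [OF add.hyps(2)]]
  have "partial_deriv i (\<lambda>x. f x + g x) = (\<lambda>x. partial_deriv i f x + partial_deriv i g x)" for i
    by (auto simp: partial_deriv_add diff)
  with add show ?case
    by (simp add: partial_deriv_add diff)
next
  case (mult f g)
  note diff = differentiable_at_real_polynomial_function [OF mult.hyps(1)]
    differentiable_at_real_polynomial_function [OF mult.hyps(2)]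
    differentiable_at_real_polynomial_function [OF real_polynomial_partial_deriv [OF mult.hyps(1)]]
    differentiable_at_real_polynomial_function [OF real_polynomial_partial_deriv [OF mult.hyps(2)]]
  have "partial_deriv i (\<lambda>x. f x * g x) = (\<lambda>x. partial_deriv i f x * g x + f x * partial_deriv i g x)" for i
    by (auto simp: partial_deriv_mult diff)
  with mult show ?case
    by (simp add: partial_deriv_add partial_deriv_mult diff)
qed


section \<open>Matrix-valued functions\<close>

lemma matrix_mul_minus_left: "(- A) ** B = - (A ** B :: 'a::ring_1^'n^'m)"
  by (simp add: matrix_matrix_mult_def vec_eq_iff sum_negf)

lemma matrix_mul_minus_right: "A ** (- B) = - (A ** B :: 'a::ring_1^'n^'m)"
  by (simp add: matrix_matrix_mult_def vec_eq_iff sum_negf)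

lemma matrix_add_rdistrib: "(A + B) ** C = A ** C + (B ** C :: 'a::ring_1^'n^'m)"
  by (simp add: matrix_matrix_mult_def vec_eq_iff sum.distrib algebra_simps)

lemma matrix_diff_ldistrib: "A ** (B - C) = A ** B - (A ** C :: 'a::ring_1^'n^'m)"
  by (simp add: matrix_matrix_mult_def vec_eq_iff sum_subtractf algebra_simps)

lemma matrix_diff_rdistrib: "(A - B) ** C = A ** C - (B ** C :: 'a::ring_1^'n^'m)"
  by (simp add: matrix_matrix_mult_def vec_eq_iff sum_subtractf algebra_simps)

lemma transpose_add: "transpose (A + B) = transpose A + transpose B"
  for A B :: "real^'m^'k"
  by (simp add: transpose_def vec_eq_iff)

lemmas matrix_ring_simps = matrix_mul_minus_left matrix_mul_minus_right matrix_add_ldistrib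
  matrix_add_rdistrib matrix_diff_ldistrib matrix_diff_rdistrib matrix_mul_assoc

lemma matrix_mul_nth: "(A ** B) $ i $ j = (\<Sum>k\<in>UNIV. A $ i $ k * B $ k $ j)"
  by (simp add: matrix_matrix_mult_def)

definition entries_differentiable :: "(real^'n::finite \<Rightarrow> real^'a^'b) \<Rightarrow> real^'n \<Rightarrow> bool" where
  "entries_differentiable M p \<longleftrightarrow> (\<forall>i j. (\<lambda>x. M x $ i $ j) differentiable (at p))"

definition matrix_deriv :: "'n::finite \<Rightarrow> (real^'n \<Rightarrow> real^'a^'b) \<Rightarrow> real^'n \<Rightarrow> real^'a^'b" where
  "matrix_deriv q M p = (\<chi> i j. partial_deriv q (\<lambda>x. M x $ i $ j) p)"

lemma matrix_deriv_const [simp]: "matrix_deriv q (\<lambda>x. C) p = 0"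
  by (simp add: matrix_deriv_def vec_eq_iff)

lemma matrix_deriv_transpose: "matrix_deriv q (\<lambda>x. transpose (M x)) p = transpose (matrix_deriv q M p)"
  by (simp add: matrix_deriv_def transpose_def)

lemma entries_differentiable_transpose:
  "entries_differentiable (\<lambda>x. transpose (M x)) p = entries_differentiable M p"
  by (auto simp: entries_differentiable_def transpose_def)

lemma matrix_deriv_diff:
  assumes "entries_differentiable M p" "entries_differentiable N p"
  shows "matrix_deriv q (\<lambda>x. M x - N x) p = matrix_deriv q M p - matrix_deriv q N p"
    and "entries_differentiable (\<lambda>x. M x - N x) p"
  using assms by (auto simp: matrix_deriv_def entries_differentiable_def vec_eq_iff partial_deriv_diff)

lemma matrix_deriv_mul:
  assumes "entries_differentiable M p" "entries_differentiable N p"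
  shows "matrix_deriv q (\<lambda>x. M x ** N x) p = matrix_deriv q M p ** N p + M p ** matrix_deriv q N p"
    and "entries_differentiable (\<lambda>x. M x ** N x) p"
  using assms
  by (auto simp: matrix_deriv_def entries_differentiable_def vec_eq_iff matrix_mul_nth
      partial_deriv_sum partial_deriv_mult sum.distrib)

lemma matrix_deriv_local:
  assumes "open S" "p \<in> S" "\<And>x. x \<in> S \<Longrightarrow> M x = N x" "entries_differentiable M p"
  shows "matrix_deriv q N p = matrix_deriv q M p"
proof -
  have "partial_deriv q (\<lambda>x. N x $ i $ j) p = partial_deriv q (\<lambda>x. M x $ i $ j) p" for i j
    by (rule partial_deriv_local [OF assms(1,2)]) (use assms(3,4) in \<open>auto simp: entries_differentiable_def\<close>)
  then show ?thesis
    by (simp add: matrix_deriv_def)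
qed


section \<open>Uniqueness of the Levi-Civita connection\<close>

lemma matrix_inv_mul: "invertible (A :: 'a::semiring_1^'n^'m) \<Longrightarrow> matrix_inv A ** A = mat 1"
  unfolding invertible_def matrix_inv_def by (rule someI2_ex) auto

text \<open>
  The uniqueness half of the fundamental theorem of Riemannian geometry, in coordinates.  With the
  upper index of \<open>T\<close> lowered, compatibility writes every derivative of the metric as a sum of two
  coefficients; in the combination that defines the Christoffel symbols, torsion-freeness makes all
  but two equal ones cancel.
\<close>

lemma christoffel_unique:
  fixes g :: "'n::finite metric" and T :: "'n \<Rightarrow> real^'n^'n" and p :: "real^'n"
  defines "G \<equiv> metric_coeff g p"
  assumes inv: "invertible G" and sym: "transpose G = G"
    and torsion_free: "\<And>i j k. T i $ k $ j = T j $ k $ i"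
    and compatible: "\<And>q. matrix_deriv q (metric_coeff g) p = transpose (T q) ** G + G ** T q"
  shows "christoffel g k i j p = T i $ k $ j"
proof -
  define L where "L q i j = (G ** T i) $ q $ j" for q i j
  have L_sym: "L q i j = L q j i" for q i j
    unfolding L_def matrix_mul_nth torsion_free [of i _ j] ..
  have dG: "partial_deriv q (\<lambda>x. metric_coeff g x $ i $ j) p = L j q i + L i q j" for q i j
  proof -
    have "transpose (T q) ** G = transpose (G ** T q)"
      by (simp add: matrix_transpose_mul sym)
    then have "matrix_deriv q (metric_coeff g) p $ i $ j = L j q i + L i q j"
      unfolding compatible by (simp add: L_def transpose_def)
    then show ?thesis
      by (simp add: matrix_deriv_def)
  qed
  have "partial_deriv i (\<lambda>x. metric_coeff g x $ j $ q) p
      + partial_deriv j (\<lambda>x. metric_coeff g x $ i $ q) p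
      - partial_deriv q (\<lambda>x. metric_coeff g x $ i $ j) p = 2 * L q i j" for q
    unfolding dG using L_sym [of q i j] L_sym [of i j q] L_sym [of j i q] by linarith
  then have "christoffel g k i j p = 1/2 * (\<Sum>q\<in>UNIV. matrix_inv G $ k $ q * (2 * L q i j))"
    unfolding christoffel_def G_def by (simp only:)
  also have "\<dots> = (\<Sum>q\<in>UNIV. matrix_inv G $ k $ q * L q i j)"
    unfolding sum_distrib_left by (intro sum.cong) auto
  also have "\<dots> = (matrix_inv G ** (G ** T i)) $ k $ j"
    by (simp add: matrix_mul_nth L_def)
  also have "\<dots> = T i $ k $ j"
    by (simp add: matrix_mul_assoc matrix_inv_mul inv)
  finally show ?thesis .
qed

section \<open>The Ricci tensor in an orthonormal frame\<close>

lemma ricci_eq_sum: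
  "ricci g p u v = (\<Sum>k\<in>UNIV. \<Sum>b\<in>UNIV. \<Sum>c\<in>UNIV. riemann_coeff g k k b c p * u $ b * v $ c)"
proof -
  have "curvature g p (axis k 1) u v $ k = (\<Sum>b\<in>UNIV. \<Sum>c\<in>UNIV. riemann_coeff g k k b c p * u $ b * v $ c)" for k
  proof -
    have "curvature g p (axis k 1) u v $ k
        = (\<Sum>a\<in>UNIV. if k = a then (\<Sum>b\<in>UNIV. \<Sum>c\<in>UNIV. riemann_coeff g k a b c p * u $ b * v $ c) else 0)"
      unfolding curvature_def vec_lambda_beta
      by (intro sum.cong refl) (auto simp: axis_def)
    then show ?thesis
      by simp
  qed
  then show ?thesis
    by (simp add: ricci_def trace_def matrix_def)
qed

text \<open>
  If \<open>c \<gamma> \<alpha> \<beta>\<close> is the coefficient of \<open>E\<^sub>\<gamma>\<close> in the bracket \<open>[E\<^sub>\<alpha>, E\<^sub>\<beta>]\<close> of the members of an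
  orthonormal frame, this is \<open>g(\<nabla>\<^sub>\<alpha> E\<^sub>\<beta>, E\<^sub>\<gamma>)\<close> with \<open>\<nabla>\<^sub>\<alpha>\<close> the derivative along \<open>E\<^sub>\<alpha>\<close>: in the Koszul formula the derivatives of the
  constant inner products drop out.
\<close>

definition koszul :: "('n \<Rightarrow> 'n \<Rightarrow> 'n \<Rightarrow> real^'n::finite \<Rightarrow> real) \<Rightarrow> 'n \<Rightarrow> 'n \<Rightarrow> 'n \<Rightarrow> real^'n \<Rightarrow> real"
  where "koszul c \<gamma> \<alpha> \<beta> x = (c \<gamma> \<alpha> \<beta> x - c \<beta> \<alpha> \<gamma> x - c \<alpha> \<beta> \<gamma> x) / 2"

text \<open>
  The rows of \<open>E x\<close> are the coordinate components of the frame at \<open>x\<close>.  The structure functions \<open>c\<close>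
  are data of the locale, because for a concrete frame they are best supplied in closed form.
\<close>

locale orthonormal_frame =
  fixes g :: "'n::finite metric" and S :: "(real^'n) set"
    and E :: "real^'n \<Rightarrow> real^'n^'n" and c :: "'n \<Rightarrow> 'n \<Rightarrow> 'n \<Rightarrow> real^'n \<Rightarrow> real"
  assumes open_domain: "open S"
    and bilinear_metric: "x \<in> S \<Longrightarrow> bilinear (g x)"
    and symmetric_metric: "x \<in> S \<Longrightarrow> g x u v = g x v u"
    and orthonormal: "x \<in> S \<Longrightarrow> g x (E x $ \<alpha>) (E x $ \<beta>) = (if \<alpha> = \<beta> then 1 else 0)"
    and metric_differentiable: "x \<in> S \<Longrightarrow> entries_differentiable (metric_coeff g) x"
    and frame_differentiable: "x \<in> S \<Longrightarrow> entries_differentiable E x"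
    and frame_deriv_differentiable: "x \<in> S \<Longrightarrow> entries_differentiable (matrix_deriv i E) x"
    and frame_deriv_commute:
      "x \<in> S \<Longrightarrow> matrix_deriv i (matrix_deriv j E) x = matrix_deriv j (matrix_deriv i E) x"
    and structure_differentiable: "x \<in> S \<Longrightarrow> c \<gamma> \<alpha> \<beta> differentiable (at x)"
    and structure_antisym: "x \<in> S \<Longrightarrow> c \<gamma> \<alpha> \<beta> x = - c \<gamma> \<beta> \<alpha> x"
    and bracket: "x \<in> S \<Longrightarrow>
      dir_deriv (E x $ \<alpha>) (\<lambda>x. E x $ \<beta> $ k) x - dir_deriv (E x $ \<beta>) (\<lambda>x. E x $ \<alpha> $ k) x
        = (\<Sum>\<gamma>\<in>UNIV. c \<gamma> \<alpha> \<beta> x * E x $ \<gamma> $ k)"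
begin

abbreviation "conn \<equiv> koszul c"

lemma conn_torsion_free: "x \<in> S \<Longrightarrow> conn \<gamma> \<alpha> \<beta> x - conn \<gamma> \<beta> \<alpha> x = c \<gamma> \<alpha> \<beta> x"
  using structure_antisym [of x \<gamma> \<beta> \<alpha>] structure_antisym [of x \<beta> \<alpha> \<gamma>] structure_antisym [of x \<alpha> \<beta> \<gamma>]
    structure_antisym [of x \<beta> \<gamma> \<alpha>] structure_antisym [of x \<alpha> \<gamma> \<beta>]
  by (simp add: koszul_def field_simps)

lemma conn_antisym: "x \<in> S \<Longrightarrow> conn \<gamma> \<alpha> \<beta> x = - conn \<beta> \<alpha> \<gamma> x"
  using structure_antisym [of x \<alpha> \<beta> \<gamma>]
  by (simp add: koszul_def field_simps)

lemma conn_differentiable: "x \<in> S \<Longrightarrow> conn \<gamma> \<alpha> \<beta> differentiable (at x)"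
  unfolding koszul_def [abs_def]
  by (intro differentiable_divide differentiable_diff structure_differentiable) auto

abbreviation "G \<equiv> metric_coeff g"

text \<open>
  \<open>P\<close> converts frame components into coordinate components and \<open>Q\<close> is its inverse.  Orthonormality
  allows \<open>Q\<close> to be written without a matrix inverse, so that its differentiability is inherited
  from the metric and the frame.
\<close>

definition P :: "real^'n \<Rightarrow> real^'n^'n" where
  "P x = transpose (E x)"

definition Q :: "real^'n \<Rightarrow> real^'n^'n" where
  "Q x = E x ** G x"

lemma transpose_G: "x \<in> S \<Longrightarrow> transpose (G x) = G x"
  by (simp add: metric_coeff_def transpose_def vec_eq_iff symmetric_metric)

lemma metric_via_coeff:
  assumes "x \<in> S"
  shows "g x u v = (\<Sum>i\<in>UNIV. \<Sum>j\<in>UNIV. u $ i * G x $ i $ j * v $ j)"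
proof -
  have "g x u v = g x (\<Sum>i\<in>UNIV. u $ i *\<^sub>R axis i 1) (\<Sum>j\<in>UNIV. v $ j *\<^sub>R axis j 1)"
    using basis_expansion [of u] basis_expansion [of v] by (simp add: scalar_mult_eq_scaleR)
  also have "\<dots> = (\<Sum>i\<in>UNIV. \<Sum>j\<in>UNIV. u $ i * G x $ i $ j * v $ j)"
    using bilinear_metric [OF assms]
    by (simp add: bilinear_sum sum.cartesian_product' bilinear_lmul bilinear_rmul metric_coeff_def
        case_prod_unfold mult_ac sum.cartesian_product)
  finally show ?thesis .
qed

lemma QP:
  assumes "x \<in> S"
  shows "Q x ** P x = mat 1"
proof -
  have "(Q x ** P x) $ \<alpha> $ \<beta> = g x (E x $ \<alpha>) (E x $ \<beta>)" for \<alpha> \<beta>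
    unfolding metric_via_coeff [OF assms] Q_def P_def matrix_mul_nth transpose_def vec_lambda_beta
      sum_distrib_right by (rule sum.swap)
  then show ?thesis
    by (simp add: vec_eq_iff mat_def orthonormal assms)
qed

lemma PQ: "x \<in> S \<Longrightarrow> P x ** Q x = mat 1"
  using QP matrix_left_right_inverse by blast

lemma G_eq:
  assumes "x \<in> S"
  shows "G x = transpose (Q x) ** Q x"
proof -
  have "transpose (Q x) = G x ** P x"
    by (simp add: Q_def P_def matrix_transpose_mul transpose_G assms)
  then show ?thesis
    using PQ [OF assms] by (simp add: matrix_mul_assoc [symmetric])
qed

lemma invertible_G:
  assumes "x \<in> S"
  shows "invertible (G x)"
proof -
  have "(P x ** E x) ** G x = mat 1"
    using PQ [OF assms] by (simp add: Q_def matrix_mul_assoc)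
  then show ?thesis
    using invertible_left_inverse by blast
qed

lemma P_differentiable: "x \<in> S \<Longrightarrow> entries_differentiable P x"
  unfolding P_def [abs_def] by (simp add: entries_differentiable_transpose frame_differentiable)

lemma Q_differentiable: "x \<in> S \<Longrightarrow> entries_differentiable Q x"
  unfolding Q_def [abs_def] by (simp add: matrix_deriv_mul frame_differentiable metric_differentiable)

lemma matrix_deriv_P: "matrix_deriv i P x = transpose (matrix_deriv i E x)"
  unfolding P_def [abs_def] by (simp add: matrix_deriv_transpose)

lemma matrix_deriv_P_differentiable: "x \<in> S \<Longrightarrow> entries_differentiable (matrix_deriv i P) x"
  unfolding matrix_deriv_P [abs_def]
  by (simp add: entries_differentiable_transpose frame_deriv_differentiable)

lemma matrix_deriv_P_commute:
  "x \<in> S \<Longrightarrow> matrix_deriv i (matrix_deriv j P) x = matrix_deriv j (matrix_deriv i P) x"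
  unfolding matrix_deriv_P [abs_def]
  by (simp add: matrix_deriv_transpose frame_deriv_commute)

lemma matrix_deriv_Q:
  assumes "x \<in> S"
  shows "matrix_deriv i Q x = - (Q x ** matrix_deriv i P x ** Q x)"
proof -
  have "matrix_deriv i (\<lambda>x. Q x ** P x) x = 0"
    using matrix_deriv_local [OF open_domain assms, of "\<lambda>x. mat 1" "\<lambda>x. Q x ** P x" i] QP
    by (simp add: entries_differentiable_def)
  then have "matrix_deriv i Q x ** P x + Q x ** matrix_deriv i P x = 0"
    using assms by (simp add: matrix_deriv_mul P_differentiable Q_differentiable)
  then have "matrix_deriv i Q x ** P x = - (Q x ** matrix_deriv i P x)"
    by (simp add: eq_neg_iff_add_eq_0)
  then have "matrix_deriv i Q x ** (P x ** Q x) = - (Q x ** matrix_deriv i P x) ** Q x"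
    by (simp add: matrix_mul_assoc)
  then show ?thesis
    by (simp add: PQ [OF assms] matrix_mul_minus_left)
qed

text \<open>
  The connection given by \<open>conn\<close>, in two bases: column \<open>\<beta>\<close> of \<open>\<omega> i\<close> consists of the frame components of
  \<open>\<nabla>\<^sub>i E\<^sub>\<beta>\<close>, and column \<open>j\<close> of \<open>\<Gamma> i\<close> of the coordinate components of \<open>\<nabla>\<^sub>i \<partial>\<^sub>j\<close>, where \<open>\<nabla>\<^sub>i\<close> is the
  derivative along \<open>\<partial>\<^sub>i\<close>.  Since \<open>\<nabla>\<^sub>i P = \<partial>\<^sub>i P + \<Gamma>\<^sub>i P\<close> must be \<open>P \<omega>\<^sub>i\<close>, the second is determined by the first.
\<close>

definition \<omega> :: "'n \<Rightarrow> real^'n \<Rightarrow> real^'n^'n" where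
  "\<omega> i x = (\<chi> \<gamma> \<beta>. \<Sum>\<alpha>\<in>UNIV. Q x $ \<alpha> $ i * conn \<gamma> \<alpha> \<beta> x)"

definition \<Gamma> :: "'n \<Rightarrow> real^'n \<Rightarrow> real^'n^'n" where
  "\<Gamma> i x = (P x ** \<omega> i x - matrix_deriv i P x) ** Q x"

lemma frame_dual: "x \<in> S \<Longrightarrow> (\<Sum>i\<in>UNIV. E x $ \<alpha> $ i * Q x $ \<beta> $ i) = (if \<alpha> = \<beta> then 1 else 0)"
  using QP [of x] by (auto simp: vec_eq_iff matrix_mul_nth P_def transpose_def mat_def mult.commute)

lemma frame_omega:
  assumes "x \<in> S"
  shows "(\<Sum>i\<in>UNIV. E x $ \<alpha> $ i * \<omega> i x $ \<gamma> $ \<beta>) = conn \<gamma> \<alpha> \<beta> x"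
proof -
  have "(\<Sum>i\<in>UNIV. E x $ \<alpha> $ i * \<omega> i x $ \<gamma> $ \<beta>)
      = (\<Sum>\<delta>\<in>UNIV. (\<Sum>i\<in>UNIV. E x $ \<alpha> $ i * Q x $ \<delta> $ i) * conn \<gamma> \<delta> \<beta> x)"
    unfolding \<omega>_def vec_lambda_beta sum_distrib_left sum_distrib_right mult.assoc
    by (rule sum.swap)
  also have "\<dots> = (\<Sum>\<delta>\<in>UNIV. if \<alpha> = \<delta> then conn \<gamma> \<delta> \<beta> x else 0)"
    by (intro sum.cong) (auto simp: frame_dual assms)
  finally show ?thesis
    by simp
qed

lemma omega_differentiable: "x \<in> S \<Longrightarrow> entries_differentiable (\<omega> i) x"
  using Q_differentiable [of x] conn_differentiable
  by (auto simp: \<omega>_def entries_differentiable_def intro!: differentiable_sum differentiable_mult)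

lemma omega_antisym:
  assumes "x \<in> S"
  shows "transpose (\<omega> i x) = - \<omega> i x"
proof -
  have flip: "\<omega> i x $ \<beta> $ \<gamma> = - (\<omega> i x $ \<gamma> $ \<beta>)" for \<beta> \<gamma>
    unfolding \<omega>_def vec_lambda_beta sum_negf [symmetric]
    by (intro sum.cong refl) (simp add: conn_antisym [OF assms, of \<beta> _ \<gamma>])
  show ?thesis
    unfolding vec_eq_iff transpose_def vec_lambda_beta vector_uminus_component using flip by blast
qed

text \<open>
  Contracted with two frame vectors, the symmetry of \<open>\<Gamma>\<close> in its lower indices becomes
  \<open>\<nabla>\<^sub>\<alpha> E\<^sub>\<beta> - \<nabla>\<^sub>\<beta> E\<^sub>\<alpha> = [E\<^sub>\<alpha>, E\<^sub>\<beta>]\<close>, which is how the structure functions enter \<open>conn\<close>.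
\<close>

lemma Gamma_torsion_free:
  assumes "x \<in> S"
  shows "\<Gamma> i x $ k $ j = \<Gamma> j x $ k $ i"
proof -
  \<comment> \<open>\<open>N\<close> is the component \<open>k\<close> of \<open>\<Gamma>\<close> as a bilinear form in the coordinate basis, \<open>M\<close> the same form in the frame.\<close>
  define N where "N = (\<chi> i j. \<Gamma> i x $ k $ j)"
  define M where "M = E x ** N ** transpose (E x)"
  have TP: "\<Gamma> i x ** P x = P x ** \<omega> i x - matrix_deriv i P x" for i
    unfolding \<Gamma>_def using QP [OF assms] by (simp add: matrix_mul_assoc [symmetric])
  have M_eq: "M $ \<alpha> $ \<beta> = (\<Sum>\<gamma>\<in>UNIV. conn \<gamma> \<alpha> \<beta> x * E x $ \<gamma> $ k) - dir_deriv (E x $ \<alpha>) (\<lambda>x. E x $ \<beta> $ k) x"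
    for \<alpha> \<beta>
  proof -
    have "M $ \<alpha> $ \<beta> = (\<Sum>i\<in>UNIV. E x $ \<alpha> $ i * (\<Gamma> i x ** P x) $ k $ \<beta>)"
      by (simp add: M_def N_def P_def matrix_mul_assoc [symmetric] matrix_mul_nth transpose_def)
    also have "\<dots> = (\<Sum>i\<in>UNIV. E x $ \<alpha> $ i * (P x ** \<omega> i x) $ k $ \<beta>)
        - dir_deriv (E x $ \<alpha>) (\<lambda>x. E x $ \<beta> $ k) x"
      unfolding TP matrix_deriv_P
      by (simp add: dir_deriv_def right_diff_distrib sum_subtractf transpose_def matrix_deriv_def)
    also have "(\<Sum>i\<in>UNIV. E x $ \<alpha> $ i * (P x ** \<omega> i x) $ k $ \<beta>)
        = (\<Sum>\<gamma>\<in>UNIV. (\<Sum>i\<in>UNIV. E x $ \<alpha> $ i * \<omega> i x $ \<gamma> $ \<beta>) * E x $ \<gamma> $ k)"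
      unfolding matrix_mul_nth P_def transpose_def vec_lambda_beta sum_distrib_left sum_distrib_right
      by (subst sum.swap) (simp add: mult_ac)
    finally show ?thesis
      by (simp add: frame_omega assms)
  qed
  have "M $ \<alpha> $ \<beta> = M $ \<beta> $ \<alpha>" for \<alpha> \<beta>
  proof -
    have "(\<Sum>\<gamma>\<in>UNIV. conn \<gamma> \<alpha> \<beta> x * E x $ \<gamma> $ k) - (\<Sum>\<gamma>\<in>UNIV. conn \<gamma> \<beta> \<alpha> x * E x $ \<gamma> $ k)
        = (\<Sum>\<gamma>\<in>UNIV. c \<gamma> \<alpha> \<beta> x * E x $ \<gamma> $ k)"
      unfolding sum_subtractf [symmetric] left_diff_distrib [symmetric]
      by (simp add: conn_torsion_free assms)
    with bracket [OF assms, of \<alpha> \<beta> k] show ?thesis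
      unfolding M_eq by linarith
  qed
  then have M_sym: "transpose M = M"
    by (simp add: transpose_def vec_eq_iff)
  have "N = transpose (Q x) ** M ** Q x"
  proof -
    have "transpose (Q x) ** E x = mat 1"
      using arg_cong [OF PQ [OF assms], of transpose] by (simp add: matrix_transpose_mul P_def)
    moreover have "transpose (Q x) ** M ** Q x = (transpose (Q x) ** E x) ** N ** (P x ** Q x)"
      by (simp add: M_def P_def matrix_mul_assoc)
    ultimately show ?thesis
      by (simp add: PQ [OF assms])
  qed
  then have "transpose N = N"
    by (simp add: matrix_transpose_mul M_sym matrix_mul_assoc)
  then show ?thesis
    by (simp add: N_def transpose_def vec_eq_iff)
qed

text \<open>
  In terms of the coframe \<open>G = Q\<^sup>T Q\<close>, so \<open>\<partial>G\<close> consists of the terms with \<open>\<partial>Q\<close>; the remaining terms of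
  \<open>\<Gamma>\<^sup>T G + G \<Gamma>\<close> are \<open>Q\<^sup>T (\<omega>\<^sup>T + \<omega>) Q\<close> and vanish because \<open>\<omega>\<close> is skew-symmetric.
\<close>

lemma Gamma_compatible:
  assumes "x \<in> S"
  shows "matrix_deriv q G x = transpose (\<Gamma> q x) ** G x + G x ** \<Gamma> q x"
proof -
  have GT: "G x ** \<Gamma> q x = transpose (Q x) ** \<omega> q x ** Q x + transpose (Q x) ** matrix_deriv q Q x"
  proof -
    have "G x ** \<Gamma> q x = transpose (Q x) ** (Q x ** P x) ** \<omega> q x ** Q x
        - transpose (Q x) ** (Q x ** matrix_deriv q P x ** Q x)"
      unfolding G_eq [OF assms] \<Gamma>_def by (simp add: matrix_ring_simps)
    then show ?thesis
      by (simp add: QP [OF assms] matrix_deriv_Q [OF assms] matrix_mul_minus_right)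
  qed
  have "transpose (\<Gamma> q x) ** G x = transpose (G x ** \<Gamma> q x)"
    by (simp add: matrix_transpose_mul transpose_G [OF assms])
  also have "\<dots> = - (transpose (Q x) ** \<omega> q x ** Q x) + transpose (matrix_deriv q Q x) ** Q x"
    unfolding GT by (simp add: transpose_add matrix_transpose_mul omega_antisym [OF assms]
        matrix_mul_minus_right matrix_mul_minus_left matrix_mul_assoc)
  finally have "transpose (\<Gamma> q x) ** G x + G x ** \<Gamma> q x
      = transpose (matrix_deriv q Q x) ** Q x + transpose (Q x) ** matrix_deriv q Q x"
    using GT by simp
  also have "\<dots> = matrix_deriv q (\<lambda>x. transpose (Q x) ** Q x) x"
    using Q_differentiable [OF assms]
    by (simp add: matrix_deriv_mul entries_differentiable_transpose matrix_deriv_transpose)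
  also have "\<dots> = matrix_deriv q G x"
    using matrix_deriv_local [OF open_domain assms, of G "\<lambda>x. transpose (Q x) ** Q x" q]
      G_eq metric_differentiable [OF assms] by simp
  finally show ?thesis
    by simp
qed

lemma christoffel_eq_Gamma: "x \<in> S \<Longrightarrow> christoffel g k i j x = \<Gamma> i x $ k $ j"
  by (rule christoffel_unique [where T = "\<lambda>i. \<Gamma> i x"])
    (use Gamma_torsion_free Gamma_compatible invertible_G transpose_G in auto)

lemma Gamma_differentiable:
  assumes "x \<in> S"
  shows "entries_differentiable (\<Gamma> i) x"
  unfolding \<Gamma>_def [abs_def]
  by (intro matrix_deriv_mul matrix_deriv_diff P_differentiable omega_differentiable Q_differentiable
      matrix_deriv_P_differentiable assms)

text \<open>The curvature form \<open>d\<omega> + \<omega> \<and> \<omega>\<close>, evaluated on \<open>\<partial>\<^sub>a, \<partial>\<^sub>b\<close>.\<close>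

definition \<Omega> :: "'n \<Rightarrow> 'n \<Rightarrow> real^'n \<Rightarrow> real^'n^'n" where
  "\<Omega> a b x = matrix_deriv a (\<omega> b) x - matrix_deriv b (\<omega> a) x + (\<omega> a x ** \<omega> b x - \<omega> b x ** \<omega> a x)"

lemma riemann_coeff_Gamma:
  assumes "x \<in> S"
  shows "riemann_coeff g k a b j x
    = (matrix_deriv a (\<Gamma> b) x - matrix_deriv b (\<Gamma> a) x + (\<Gamma> a x ** \<Gamma> b x - \<Gamma> b x ** \<Gamma> a x)) $ k $ j"
proof -
  have "partial_deriv a (christoffel g k b j) x = matrix_deriv a (\<Gamma> b) x $ k $ j" for a b
  proof -
    have "(\<lambda>x. \<Gamma> b x $ k $ j) differentiable (at x)"
      using Gamma_differentiable [OF assms] by (simp add: entries_differentiable_def)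
    then have "partial_deriv a (christoffel g k b j) x = partial_deriv a (\<lambda>x. \<Gamma> b x $ k $ j) x"
      by (intro partial_deriv_local [OF open_domain assms]) (simp_all add: christoffel_eq_Gamma)
    then show ?thesis
      by (simp add: matrix_deriv_def)
  qed
  then show ?thesis
    by (simp add: riemann_coeff_def christoffel_eq_Gamma assms matrix_mul_nth sum_subtractf)
qed

text \<open>
  The curvature is a tensor although \<open>\<Gamma>\<close> is not: all terms that contain derivatives of \<open>P\<close> are
  symmetric in the two directions \<open>a\<close> and \<open>b\<close> and disappear on antisymmetrization.  This uses that the
  second derivatives of the frame commute.
\<close>

lemma curvature_gauge:
  assumes "x \<in> S"
  shows "matrix_deriv a (\<Gamma> b) x - matrix_deriv b (\<Gamma> a) x + (\<Gamma> a x ** \<Gamma> b x - \<Gamma> b x ** \<Gamma> a x)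
    = P x ** \<Omega> a b x ** Q x"
proof -
  let ?P = "P x" and ?Q = "Q x" and ?W = "\<lambda>a. \<omega> a x" and ?dP = "\<lambda>a. matrix_deriv a P x"
  let ?ddP = "\<lambda>a b. matrix_deriv a (matrix_deriv b P) x" and ?dW = "\<lambda>a b. matrix_deriv a (\<omega> b) x"
  \<comment> \<open>\<open>Y\<close> is the part that survives, \<open>Z\<close> collects the derivatives of the frame.\<close>
  define Y where "Y a b = ?P ** ?dW a b + ?P ** ?W a ** ?W b" for a b
  define Z where "Z a b = ?ddP a b + ?P ** ?W b ** ?Q ** ?dP a + ?P ** ?W a ** ?Q ** ?dP b
    - ?dP b ** ?Q ** ?dP a - ?dP a ** ?Q ** ?dP b" for a b
  have half: "matrix_deriv a (\<Gamma> b) x + \<Gamma> a x ** \<Gamma> b x = (Y a b - Z a b) ** ?Q" for a b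
  proof -
    have dT: "matrix_deriv a (\<Gamma> b) x = (?dP a ** ?W b + ?P ** ?dW a b - ?ddP a b) ** ?Q
        - (?P ** ?W b - ?dP b) ** (?Q ** ?dP a ** ?Q)"
      unfolding \<Gamma>_def [abs_def]
      by (simp add: matrix_deriv_mul matrix_deriv_diff P_differentiable omega_differentiable Q_differentiable
          matrix_deriv_P_differentiable assms matrix_deriv_Q matrix_mul_minus_right)
    have TT: "\<Gamma> a x ** \<Gamma> b x = ((?P ** ?W a - ?dP a) ** ((?Q ** ?P) ** ?W b - ?Q ** ?dP b)) ** ?Q"
      unfolding \<Gamma>_def by (simp add: matrix_ring_simps)
    show ?thesis
      unfolding dT TT QP [OF assms] Y_def Z_def by (simp add: matrix_ring_simps algebra_simps)
  qed
  have "Z a b = Z b a"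
    unfolding Z_def using matrix_deriv_P_commute [OF assms, of a b] by (simp add: algebra_simps)
  then have "matrix_deriv a (\<Gamma> b) x + \<Gamma> a x ** \<Gamma> b x - (matrix_deriv b (\<Gamma> a) x + \<Gamma> b x ** \<Gamma> a x)
      = (Y a b - Y b a) ** ?Q"
    unfolding half by (simp add: matrix_diff_rdistrib)
  also have "Y a b - Y b a = ?P ** \<Omega> a b x"
    unfolding Y_def \<Omega>_def by (simp add: matrix_ring_simps algebra_simps)
  finally show ?thesis
    by (simp add: algebra_simps)
qed

text \<open>
  A trace can be taken in any basis; applied to \<open>E\<^sub>\<delta>\<close>, the factor \<open>Q\<close> of the conjugation becomes a
  unit vector.
\<close>

lemma ricci_Omega:
  assumes "x \<in> S"
  shows "ricci g x (E x $ \<beta>) (E x $ \<delta>)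
    = (\<Sum>\<gamma>\<in>UNIV. \<Sum>k\<in>UNIV. \<Sum>b\<in>UNIV. E x $ \<gamma> $ k * E x $ \<beta> $ b * \<Omega> k b x $ \<gamma> $ \<delta>)"
proof -
  have *: "(\<Sum>j\<in>UNIV. riemann_coeff g k a b j x * E x $ \<delta> $ j) = (\<Sum>\<gamma>\<in>UNIV. E x $ \<gamma> $ k * \<Omega> a b x $ \<gamma> $ \<delta>)"
    for k a b
  proof -
    have PE: "P x $ j $ \<delta> = E x $ \<delta> $ j" for j
      by (simp add: P_def transpose_def)
    have "(\<Sum>j\<in>UNIV. riemann_coeff g k a b j x * E x $ \<delta> $ j)
        = ((P x ** \<Omega> a b x ** Q x) ** P x) $ k $ \<delta>"
      unfolding riemann_coeff_Gamma [OF assms] curvature_gauge [OF assms]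
      by (simp add: matrix_mul_nth [of _ "P x"] PE)
    also have "\<dots> = (P x ** \<Omega> a b x) $ k $ \<delta>"
      using QP [OF assms] by (simp add: matrix_mul_assoc [symmetric])
    finally show ?thesis
      by (simp add: matrix_mul_nth P_def transpose_def)
  qed
  have "ricci g x (E x $ \<beta>) (E x $ \<delta>)
      = (\<Sum>k\<in>UNIV. \<Sum>b\<in>UNIV. E x $ \<beta> $ b * (\<Sum>j\<in>UNIV. riemann_coeff g k k b j x * E x $ \<delta> $ j))"
    unfolding ricci_eq_sum by (simp add: sum_distrib_left mult_ac)
  also have "\<dots> = (\<Sum>k\<in>UNIV. \<Sum>b\<in>UNIV. \<Sum>\<gamma>\<in>UNIV. E x $ \<gamma> $ k * E x $ \<beta> $ b * \<Omega> k b x $ \<gamma> $ \<delta>)"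
    unfolding * by (simp add: sum_distrib_left mult_ac)
  also have "\<dots> = (\<Sum>k\<in>UNIV. \<Sum>\<gamma>\<in>UNIV. \<Sum>b\<in>UNIV. E x $ \<gamma> $ k * E x $ \<beta> $ b * \<Omega> k b x $ \<gamma> $ \<delta>)"
    by (intro sum.cong refl sum.swap)
  also have "\<dots> = (\<Sum>\<gamma>\<in>UNIV. \<Sum>k\<in>UNIV. \<Sum>b\<in>UNIV. E x $ \<gamma> $ k * E x $ \<beta> $ b * \<Omega> k b x $ \<gamma> $ \<delta>)"
    by (rule sum.swap)
  finally show ?thesis .
qed

text \<open>
  The product rule moves the frame vector \<open>E\<^sub>\<beta>\<close> inside the derivative.  The correction is half of a
  bracket; the other half comes from exchanging \<open>\<gamma>\<close> and \<open>\<beta>\<close>.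
\<close>

lemma frame_deriv_omega:
  assumes "x \<in> S"
  shows "(\<Sum>k\<in>UNIV. \<Sum>b\<in>UNIV. E x $ \<gamma> $ k * E x $ \<beta> $ b * matrix_deriv k (\<omega> b) x $ \<mu> $ \<delta>)
    = dir_deriv (E x $ \<gamma>) (conn \<mu> \<beta> \<delta>) x
      - (\<Sum>b\<in>UNIV. dir_deriv (E x $ \<gamma>) (\<lambda>x. E x $ \<beta> $ b) x * \<omega> b x $ \<mu> $ \<delta>)"
proof -
  have "(\<Sum>b\<in>UNIV. E x $ \<beta> $ b * matrix_deriv k (\<omega> b) x $ \<mu> $ \<delta>)
      = partial_deriv k (conn \<mu> \<beta> \<delta>) x
        - (\<Sum>b\<in>UNIV. partial_deriv k (\<lambda>x. E x $ \<beta> $ b) x * \<omega> b x $ \<mu> $ \<delta>)" for k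
  proof -
    have diff: "(\<lambda>x. E x $ \<beta> $ b) differentiable (at x)" "(\<lambda>x. \<omega> b x $ \<mu> $ \<delta>) differentiable (at x)" for b
      using omega_differentiable [OF assms] frame_differentiable [OF assms]
      by (auto simp: entries_differentiable_def)
    have "partial_deriv k (conn \<mu> \<beta> \<delta>) x
        = partial_deriv k (\<lambda>x. \<Sum>b\<in>UNIV. E x $ \<beta> $ b * \<omega> b x $ \<mu> $ \<delta>) x"
      by (rule partial_deriv_local [OF open_domain assms])
        (auto simp: frame_omega intro!: differentiable_sum differentiable_mult diff)
    also have "\<dots> = (\<Sum>b\<in>UNIV. partial_deriv k (\<lambda>x. E x $ \<beta> $ b) x * \<omega> b x $ \<mu> $ \<delta>)
        + (\<Sum>b\<in>UNIV. E x $ \<beta> $ b * matrix_deriv k (\<omega> b) x $ \<mu> $ \<delta>)"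
      by (simp add: partial_deriv_sum partial_deriv_mult diff sum.distrib matrix_deriv_def)
    finally show ?thesis
      by simp
  qed
  then have "(\<Sum>k\<in>UNIV. \<Sum>b\<in>UNIV. E x $ \<gamma> $ k * E x $ \<beta> $ b * matrix_deriv k (\<omega> b) x $ \<mu> $ \<delta>)
      = (\<Sum>k\<in>UNIV. E x $ \<gamma> $ k * (partial_deriv k (conn \<mu> \<beta> \<delta>) x
        - (\<Sum>b\<in>UNIV. partial_deriv k (\<lambda>x. E x $ \<beta> $ b) x * \<omega> b x $ \<mu> $ \<delta>)))"
    by (simp add: mult.assoc sum_distrib_left [symmetric])
  also have "\<dots> = dir_deriv (E x $ \<gamma>) (conn \<mu> \<beta> \<delta>) x
      - (\<Sum>k\<in>UNIV. \<Sum>b\<in>UNIV. E x $ \<gamma> $ k * partial_deriv k (\<lambda>x. E x $ \<beta> $ b) x * \<omega> b x $ \<mu> $ \<delta>)"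
    by (simp add: right_diff_distrib sum_subtractf dir_deriv_def sum_distrib_left mult.assoc)
  also have "(\<Sum>k\<in>UNIV. \<Sum>b\<in>UNIV. E x $ \<gamma> $ k * partial_deriv k (\<lambda>x. E x $ \<beta> $ b) x * \<omega> b x $ \<mu> $ \<delta>)
      = (\<Sum>b\<in>UNIV. dir_deriv (E x $ \<gamma>) (\<lambda>x. E x $ \<beta> $ b) x * \<omega> b x $ \<mu> $ \<delta>)"
    unfolding dir_deriv_def sum_distrib_right by (rule sum.swap)
  finally show ?thesis .
qed

lemma frame_omega_mul:
  assumes "x \<in> S"
  shows "(\<Sum>k\<in>UNIV. \<Sum>b\<in>UNIV. E x $ \<gamma> $ k * E x $ \<beta> $ b * (\<omega> k x ** \<omega> b x) $ \<mu> $ \<delta>)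
    = (\<Sum>\<epsilon>\<in>UNIV. conn \<mu> \<gamma> \<epsilon> x * conn \<epsilon> \<beta> \<delta> x)" (is "?lhs = _")
proof -
  have "?lhs = (\<Sum>k\<in>UNIV. \<Sum>b\<in>UNIV. \<Sum>\<epsilon>\<in>UNIV. (E x $ \<gamma> $ k * \<omega> k x $ \<mu> $ \<epsilon>) * (E x $ \<beta> $ b * \<omega> b x $ \<epsilon> $ \<delta>))"
    by (simp add: matrix_mul_nth sum_distrib_left mult_ac)
  also have "\<dots> = (\<Sum>k\<in>UNIV. \<Sum>\<epsilon>\<in>UNIV. \<Sum>b\<in>UNIV. (E x $ \<gamma> $ k * \<omega> k x $ \<mu> $ \<epsilon>) * (E x $ \<beta> $ b * \<omega> b x $ \<epsilon> $ \<delta>))"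
    by (intro sum.cong refl sum.swap)
  also have "\<dots> = (\<Sum>\<epsilon>\<in>UNIV. \<Sum>k\<in>UNIV. \<Sum>b\<in>UNIV. (E x $ \<gamma> $ k * \<omega> k x $ \<mu> $ \<epsilon>) * (E x $ \<beta> $ b * \<omega> b x $ \<epsilon> $ \<delta>))"
    by (rule sum.swap)
  also have "\<dots> = (\<Sum>\<epsilon>\<in>UNIV. conn \<mu> \<gamma> \<epsilon> x * conn \<epsilon> \<beta> \<delta> x)"
    by (simp add: sum_product [symmetric] frame_omega assms)
  finally show ?thesis .
qed

lemma frame_Omega:
  assumes "x \<in> S"
  shows "(\<Sum>k\<in>UNIV. \<Sum>b\<in>UNIV. E x $ \<gamma> $ k * E x $ \<beta> $ b * \<Omega> k b x $ \<mu> $ \<delta>)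
    = dir_deriv (E x $ \<gamma>) (conn \<mu> \<beta> \<delta>) x - dir_deriv (E x $ \<beta>) (conn \<mu> \<gamma> \<delta>) x
      + (\<Sum>\<epsilon>\<in>UNIV. conn \<mu> \<gamma> \<epsilon> x * conn \<epsilon> \<beta> \<delta> x - conn \<mu> \<beta> \<epsilon> x * conn \<epsilon> \<gamma> \<delta> x
          - c \<epsilon> \<gamma> \<beta> x * conn \<mu> \<epsilon> \<delta> x)" (is "?lhs = _")
proof -
  \<comment> \<open>\<open>J f \<gamma> \<beta>\<close> evaluates the bilinear form with coordinate components \<open>f\<close> on \<open>E\<^sub>\<gamma>, E\<^sub>\<beta>\<close>.\<close>
  define J where "J f \<gamma> \<beta> = (\<Sum>k\<in>UNIV. \<Sum>b\<in>UNIV. E x $ \<gamma> $ k * E x $ \<beta> $ b * f k b)" for \<gamma> \<beta> f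
  have J_swap: "J (\<lambda>k b. f b k) \<gamma> \<beta> = J f \<beta> \<gamma>" for f \<gamma> \<beta>
    unfolding J_def by (subst sum.swap) (simp add: mult_ac)
  have "?lhs = J (\<lambda>k b. matrix_deriv k (\<omega> b) x $ \<mu> $ \<delta>) \<gamma> \<beta> - J (\<lambda>k b. matrix_deriv b (\<omega> k) x $ \<mu> $ \<delta>) \<gamma> \<beta>
      + (J (\<lambda>k b. (\<omega> k x ** \<omega> b x) $ \<mu> $ \<delta>) \<gamma> \<beta> - J (\<lambda>k b. (\<omega> b x ** \<omega> k x) $ \<mu> $ \<delta>) \<gamma> \<beta>)"
    by (simp add: J_def \<Omega>_def algebra_simps sum.distrib sum_subtractf)
  also have "J (\<lambda>k b. matrix_deriv b (\<omega> k) x $ \<mu> $ \<delta>) \<gamma> \<beta> = J (\<lambda>k b. matrix_deriv k (\<omega> b) x $ \<mu> $ \<delta>) \<beta> \<gamma>"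
    by (rule J_swap)
  also have "J (\<lambda>k b. (\<omega> b x ** \<omega> k x) $ \<mu> $ \<delta>) \<gamma> \<beta> = J (\<lambda>k b. (\<omega> k x ** \<omega> b x) $ \<mu> $ \<delta>) \<beta> \<gamma>"
    by (rule J_swap)
  finally have 1: "?lhs = dir_deriv (E x $ \<gamma>) (conn \<mu> \<beta> \<delta>) x - dir_deriv (E x $ \<beta>) (conn \<mu> \<gamma> \<delta>) x
      - (\<Sum>b\<in>UNIV. (dir_deriv (E x $ \<gamma>) (\<lambda>x. E x $ \<beta> $ b) x
          - dir_deriv (E x $ \<beta>) (\<lambda>x. E x $ \<gamma> $ b) x) * \<omega> b x $ \<mu> $ \<delta>)
      + (\<Sum>\<epsilon>\<in>UNIV. conn \<mu> \<gamma> \<epsilon> x * conn \<epsilon> \<beta> \<delta> x - conn \<mu> \<beta> \<epsilon> x * conn \<epsilon> \<gamma> \<delta> x)"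
    unfolding J_def frame_deriv_omega [OF assms] frame_omega_mul [OF assms]
    by (simp add: left_diff_distrib sum_subtractf)
  have "(\<Sum>b\<in>UNIV. (\<Sum>\<epsilon>\<in>UNIV. c \<epsilon> \<gamma> \<beta> x * E x $ \<epsilon> $ b) * \<omega> b x $ \<mu> $ \<delta>)
      = (\<Sum>\<epsilon>\<in>UNIV. c \<epsilon> \<gamma> \<beta> x * (\<Sum>b\<in>UNIV. E x $ \<epsilon> $ b * \<omega> b x $ \<mu> $ \<delta>))"
    unfolding sum_distrib_left sum_distrib_right mult.assoc by (rule sum.swap)
  then show ?thesis
    unfolding 1 bracket [OF assms] frame_omega [OF assms] by (simp add: sum_subtractf)
qed

text \<open>
  The trace of the curvature form.  Torsion-freeness replaces each structure function by a difference of
  connection coefficients; one half of it then cancels one of the two quadratic terms, after an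
  exchange of the two summation indices.
\<close>

lemma ricci_frame:
  assumes "x \<in> S"
  shows "ricci g x (E x $ \<beta>) (E x $ \<delta>)
    = (\<Sum>\<gamma>\<in>UNIV. dir_deriv (E x $ \<gamma>) (conn \<gamma> \<beta> \<delta>) x)
      - (\<Sum>\<gamma>\<in>UNIV. dir_deriv (E x $ \<beta>) (conn \<gamma> \<gamma> \<delta>) x)
      + (\<Sum>\<epsilon>\<in>UNIV. (\<Sum>\<gamma>\<in>UNIV. conn \<gamma> \<gamma> \<epsilon> x) * conn \<epsilon> \<beta> \<delta> x)
      - (\<Sum>\<gamma>\<in>UNIV. \<Sum>\<epsilon>\<in>UNIV. conn \<epsilon> \<gamma> \<beta> x * conn \<gamma> \<epsilon> \<delta> x)"
proof -
  have c: "c \<epsilon> \<gamma> \<beta> x = conn \<epsilon> \<gamma> \<beta> x - conn \<epsilon> \<beta> \<gamma> x" for \<epsilon> \<gamma>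
    using conn_torsion_free [OF assms] by simp
  have swap: "(\<Sum>\<gamma>\<in>UNIV. \<Sum>\<epsilon>\<in>UNIV. conn \<epsilon> \<beta> \<gamma> x * conn \<gamma> \<epsilon> \<delta> x)
      = (\<Sum>\<gamma>\<in>UNIV. \<Sum>\<epsilon>\<in>UNIV. conn \<gamma> \<beta> \<epsilon> x * conn \<epsilon> \<gamma> \<delta> x)"
    by (rule sum.swap)
  have "(\<Sum>\<epsilon>\<in>UNIV. (\<Sum>\<gamma>\<in>UNIV. conn \<gamma> \<gamma> \<epsilon> x) * conn \<epsilon> \<beta> \<delta> x)
      = (\<Sum>\<gamma>\<in>UNIV. \<Sum>\<epsilon>\<in>UNIV. conn \<gamma> \<gamma> \<epsilon> x * conn \<epsilon> \<beta> \<delta> x)"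
    unfolding sum_distrib_right by (rule sum.swap)
  then show ?thesis
    unfolding ricci_Omega [OF assms] frame_Omega [OF assms] c
    using swap by (simp add: sum.distrib sum_subtractf left_diff_distrib)
qed

end

section \<open>The structure functions of the EBCV frame\<close>

lemma vector_4 [simp]:
  fixes a b c d :: "'a::zero"
  shows "(vector [a, b, c, d] :: 'a^4) $ 1 = a"
    and "(vector [a, b, c, d] :: 'a^4) $ 2 = b"
    and "(vector [a, b, c, d] :: 'a^4) $ 3 = c"
    and "(vector [a, b, c, d] :: 'a^4) $ 4 = d"
  by (simp_all add: vector_def)

lemma sum_7: "sum f (UNIV::7 set) = f 1 + f 2 + f 3 + f 4 + f 5 + f 6 + f 7"
  unfolding UNIV_7 by (simp add: ac_simps)

text \<open>
  The indices of the frame vectors along the fibre and along the base.  Coordinates are numbered in the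
  opposite order: the base direction \<open>X\<^sub>4\<close> belongs to the coordinate \<open>w = p $ 1\<close>, and so on.
\<close>

definition vert :: "7 set" where "vert = {1, 2, 3}"

definition hor :: "7 set" where "hor = {4, 5, 6, 7}"

lemma sum_vert: "sum f vert = f 1 + f 2 + f 3"
  by (simp add: vert_def ac_simps)

lemma sum_hor: "sum f hor = f 4 + f 5 + f 6 + f 7"
  by (simp add: hor_def ac_simps)

lemma sum_vert_hor: "sum f UNIV = sum f vert + sum f hor"
  by (simp add: sum_7 sum_vert sum_hor ac_simps)

lemma vert_or_hor: "\<alpha> \<in> vert \<or> \<alpha> \<in> hor"
  using UNIV_7 by (auto simp: vert_def hor_def)

lemma not_vert_and_hor: "\<alpha> \<in> vert \<Longrightarrow> \<alpha> \<notin> hor"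
  by (auto simp: vert_def hor_def)

lemma vert_hor_simps [simp]:
  "1 \<in> vert" "2 \<in> vert" "3 \<in> vert" "4 \<in> hor" "5 \<in> hor" "6 \<in> hor" "7 \<in> hor"
  by (simp_all add: vert_def hor_def)

lemma hor_cases: "\<alpha> \<in> hor \<Longrightarrow> \<alpha> = 4 \<or> \<alpha> = 5 \<or> \<alpha> = 6 \<or> \<alpha> = 7"
  by (auto simp: hor_def)

lemma ball_vert: "(\<forall>a\<in>vert. Q a) \<longleftrightarrow> Q 1 \<and> Q 2 \<and> Q 3"
  and ball_hor: "(\<forall>a\<in>hor. Q a) \<longleftrightarrow> Q 4 \<and> Q 5 \<and> Q 6 \<and> Q 7"
  by (auto simp: vert_def hor_def)

text \<open>The position \<open>(w, x, y, z)\<close> in the base, carried to the frame indices \<open>4, \<dots>, 7\<close>.\<close>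

definition ebcv_rad :: "real^7 \<Rightarrow> real^7" where
  "ebcv_rad p = vector [0, 0, 0, p $ 1, p $ 2, p $ 3, p $ 4]"

text \<open>
  With the base components of \<open>v\<close> read as a quaternion \<open>q\<close>, the three nonzero rows are \<open>i q\<close>, \<open>j q\<close> and
  \<open>k q\<close>.  The one-forms in the metric are \<open>A\<^sup>a = l/2 \<cdot> ebcv_twist (ebcv_rad p) $ a / K\<close>.
\<close>

definition ebcv_twist :: "real^7 \<Rightarrow> real^7^7" where
  "ebcv_twist v = vector
    [vector [0, 0, 0, - v $ 5,   v $ 4, - v $ 7,   v $ 6],
     vector [0, 0, 0, - v $ 6,   v $ 7,   v $ 4, - v $ 5],
     vector [0, 0, 0, - v $ 7, - v $ 6,   v $ 5,   v $ 4], 0, 0, 0, 0]"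

text \<open>
  The frame component \<open>F\<^sup>a(X\<^sub>i, X\<^sub>j)\<close> of \<open>F\<^sup>a = dA\<^sup>a\<close>.  The first term is the derivative of the numerator of
  \<open>A\<^sup>a\<close>, which is linear in the position; the second is the derivative of \<open>1/K\<close>.
\<close>

definition ebcv_F :: "real \<Rightarrow> real \<Rightarrow> 7 \<Rightarrow> 7 \<Rightarrow> 7 \<Rightarrow> real^7 \<Rightarrow> real" where
  "ebcv_F m l a i j p = l * (ebcv_K m p * ebcv_twist (axis i 1) $ a $ j
     - m * (ebcv_rad p $ i * ebcv_twist (ebcv_rad p) $ a $ j
            - ebcv_rad p $ j * ebcv_twist (ebcv_rad p) $ a $ i))"

text \<open>The orthogonal projection to the base directions.\<close>

definition ebcv_h :: "7 \<Rightarrow> 7 \<Rightarrow> real" where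
  "ebcv_h \<alpha> \<beta> = (if \<alpha> = \<beta> \<and> \<alpha> \<in> hor then 1 else 0)"

text \<open>
  The first part gives the brackets of the fields \<open>K \<partial>\<^sub>i\<close> on the base, the second the fibre
  component \<open>- F\<^sup>a(X\<^sub>i, X\<^sub>j)\<close> of \<open>[X\<^sub>i, X\<^sub>j]\<close>; brackets with fibre fields vanish.
\<close>

definition ebcv_c :: "real \<Rightarrow> real \<Rightarrow> 7 \<Rightarrow> 7 \<Rightarrow> 7 \<Rightarrow> real^7 \<Rightarrow> real" where
  "ebcv_c m l \<gamma> \<alpha> \<beta> p = 2 * m * (ebcv_rad p $ \<alpha> * ebcv_h \<beta> \<gamma> - ebcv_rad p $ \<beta> * ebcv_h \<alpha> \<gamma>)
     - ebcv_F m l \<gamma> \<alpha> \<beta> p"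

lemma ebcv_twist_axis_antisym: "ebcv_twist (axis i 1) $ a $ j = - ebcv_twist (axis j 1) $ a $ i"
proof -
  have "\<forall>a i j. ebcv_twist (axis i 1) $ a $ j = - ebcv_twist (axis j 1) $ a $ i"
    by (simp add: forall_7 ebcv_twist_def axis_def)
  then show ?thesis
    by blast
qed

lemma ebcv_F_antisym: "ebcv_F m l a i j p = - ebcv_F m l a j i p"
  by (simp add: ebcv_F_def ebcv_twist_axis_antisym [of i a j] algebra_simps)

lemma ebcv_F_same [simp]: "ebcv_F m l a i i p = 0"
  using ebcv_F_antisym [of m l a i i p] by simp

lemma ebcv_rad_vert [simp]: "\<alpha> \<in> vert \<Longrightarrow> ebcv_rad p $ \<alpha> = 0"
  by (auto simp: vert_def ebcv_rad_def)

lemma ebcv_twist_vert [simp]: "j \<in> vert \<Longrightarrow> ebcv_twist v $ a $ j = 0"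
proof -
  have "\<forall>a. \<forall>j\<in>vert. ebcv_twist v $ a $ j = 0"
    by (simp add: forall_7 ebcv_twist_def vert_def)
  then show "j \<in> vert \<Longrightarrow> ebcv_twist v $ a $ j = 0"
    by blast
qed

lemma ebcv_twist_hor [simp]: "a \<in> hor \<Longrightarrow> ebcv_twist v $ a $ j = 0"
  by (auto simp: ebcv_twist_def hor_def)

lemma ebcv_F_hor [simp]: "a \<in> hor \<Longrightarrow> ebcv_F m l a i j p = 0"
  by (simp add: ebcv_F_def)

lemma ebcv_F_vert [simp]:
  "j \<in> vert \<Longrightarrow> ebcv_F m l a i j p = 0" "i \<in> vert \<Longrightarrow> ebcv_F m l a i j p = 0"
proof -
  show *: "ebcv_F m l a i j p = 0" if "j \<in> vert" for i j
    using that by (simp add: ebcv_F_def)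
  show "i \<in> vert \<Longrightarrow> ebcv_F m l a i j p = 0"
    using * [of i j] ebcv_F_antisym [of m l a i j p] by simp
qed

lemma real_polynomial_K: "real_polynomial_function (ebcv_K m)"
  unfolding ebcv_K_def [abs_def]
  by (intro real_polynomial_function.intros real_polynomial_function_power real_polynomial_coord)

lemma real_polynomial_frame: "real_polynomial_function (\<lambda>x. ebcv_frame m l x $ \<alpha> $ k)"
proof -
  have "\<forall>\<alpha> k. real_polynomial_function (\<lambda>x. ebcv_frame m l x $ \<alpha> $ k)"
    by (simp add: forall_7 ebcv_frame_def Let_def)
      (intro conjI real_polynomial_function.intros(2) real_polynomial_function.intros(4)
        real_polynomial_function_minus real_polynomial_function_divide real_polynomial_K
        real_polynomial_coord)
  then show ?thesis
    by blast
qed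

lemma real_polynomial_rad: "real_polynomial_function (\<lambda>x. ebcv_rad x $ \<alpha>)"
proof -
  have "\<forall>\<alpha>. real_polynomial_function (\<lambda>x. ebcv_rad x $ \<alpha>)"
    by (simp add: forall_7 ebcv_rad_def)
      (intro conjI real_polynomial_function.intros(2) real_polynomial_coord)
  then show ?thesis
    by blast
qed

lemma real_polynomial_twist: "real_polynomial_function (\<lambda>x. ebcv_twist (ebcv_rad x) $ a $ j)"
proof -
  have "\<forall>a j. real_polynomial_function (\<lambda>x. ebcv_twist (ebcv_rad x) $ a $ j)"
    by (simp add: forall_7 ebcv_twist_def ebcv_rad_def)
      (intro conjI real_polynomial_function.intros(2) real_polynomial_function_minus real_polynomial_coord)
  then show ?thesis
    by blast
qed

lemma real_polynomial_F: "real_polynomial_function (ebcv_F m l a i j)"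
  unfolding ebcv_F_def [abs_def]
  by (intro real_polynomial_function.intros(2) real_polynomial_function.intros(4)
      real_polynomial_function_diff real_polynomial_K real_polynomial_rad real_polynomial_twist)

lemma real_polynomial_c: "real_polynomial_function (ebcv_c m l \<gamma> \<alpha> \<beta>)"
  unfolding ebcv_c_def [abs_def]
  by (intro real_polynomial_function.intros(2) real_polynomial_function.intros(4)
      real_polynomial_function_diff real_polynomial_F real_polynomial_rad)

lemmas ebcv_differentiable [simp] =
  differentiable_at_real_polynomial_function [OF real_polynomial_K]
  differentiable_at_real_polynomial_function [OF real_polynomial_rad]
  differentiable_at_real_polynomial_function [OF real_polynomial_twist]
  differentiable_at_real_polynomial_function [OF real_polynomial_F]
  differentiable_at_real_polynomial_function [OF real_polynomial_c]

lemma dir_deriv_K: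
  "dir_deriv v (ebcv_K m) p = 2 * m * (v $ 1 * p $ 1 + v $ 2 * p $ 2 + v $ 3 * p $ 3 + v $ 4 * p $ 4)"
proof -
  have "(ebcv_K m has_derivative (\<lambda>v. 2 * m * (v $ 1 * p $ 1 + v $ 2 * p $ 2 + v $ 3 * p $ 3 + v $ 4 * p $ 4))) (at p)"
    unfolding ebcv_K_def [abs_def]
    by (auto intro!: derivative_eq_intros bounded_linear_imp_has_derivative bounded_linear_vec_nth
        simp: fun_eq_iff algebra_simps power2_eq_square)
  then show ?thesis
    by (rule dir_deriv_eq)
qed

lemma frame_deriv_K: "dir_deriv (ebcv_frame m l p $ \<gamma>) (ebcv_K m) p = 2 * m * ebcv_K m p * ebcv_rad p $ \<gamma>"
proof -
  have "\<forall>\<gamma>. dir_deriv (ebcv_frame m l p $ \<gamma>) (ebcv_K m) p = 2 * m * ebcv_K m p * ebcv_rad p $ \<gamma>"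
    by (simp add: forall_7 dir_deriv_K ebcv_frame_def ebcv_rad_def Let_def)
  then show ?thesis
    by blast
qed

lemma frame_deriv_rad:
  "dir_deriv (ebcv_frame m l p $ \<gamma>) (\<lambda>x. ebcv_rad x $ \<alpha>) p = ebcv_K m p * ebcv_h \<gamma> \<alpha>"
proof -
  have "\<forall>\<gamma> \<alpha>. dir_deriv (ebcv_frame m l p $ \<gamma>) (\<lambda>x. ebcv_rad x $ \<alpha>) p = ebcv_K m p * ebcv_h \<gamma> \<alpha>"
    by (simp add: forall_7 ebcv_frame_def ebcv_rad_def ebcv_h_def hor_def Let_def)
  then show ?thesis
    by blast
qed

lemma frame_deriv_twist:
  "dir_deriv (ebcv_frame m l p $ \<gamma>) (\<lambda>x. ebcv_twist (ebcv_rad x) $ a $ j) p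
    = ebcv_K m p * ebcv_twist (axis \<gamma> 1) $ a $ j"
proof -
  have "\<forall>\<gamma> a j. dir_deriv (ebcv_frame m l p $ \<gamma>) (\<lambda>x. ebcv_twist (ebcv_rad x) $ a $ j) p
      = ebcv_K m p * ebcv_twist (axis \<gamma> 1) $ a $ j"
    by (simp add: forall_7 ebcv_frame_def ebcv_rad_def ebcv_twist_def axis_def Let_def dir_deriv_uminus)
  then show ?thesis
    by blast
qed

lemma frame_deriv_F:
  "dir_deriv (ebcv_frame m l p $ \<gamma>) (ebcv_F m l a i j) p
    = l * m * ebcv_K m p * (2 * ebcv_rad p $ \<gamma> * ebcv_twist (axis i 1) $ a $ j
       - ebcv_h \<gamma> i * ebcv_twist (ebcv_rad p) $ a $ j - ebcv_rad p $ i * ebcv_twist (axis \<gamma> 1) $ a $ j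
       + ebcv_h \<gamma> j * ebcv_twist (ebcv_rad p) $ a $ i + ebcv_rad p $ j * ebcv_twist (axis \<gamma> 1) $ a $ i)"
  unfolding ebcv_F_def [abs_def]
  by (simp add: dir_deriv_diff dir_deriv_mult frame_deriv_K frame_deriv_rad frame_deriv_twist)
    (simp add: algebra_simps)

lemma frame_bracket:
  "dir_deriv (ebcv_frame m l p $ \<alpha>) (\<lambda>x. ebcv_frame m l x $ \<beta> $ k) p
    - dir_deriv (ebcv_frame m l p $ \<beta>) (\<lambda>x. ebcv_frame m l x $ \<alpha> $ k) p
    = (\<Sum>\<gamma>\<in>UNIV. ebcv_c m l \<gamma> \<alpha> \<beta> p * ebcv_frame m l p $ \<gamma> $ k)"
proof -
  have lin: "dir_deriv v (\<lambda>x. l * x $ i / 2) p = l * v $ i / 2"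
    "dir_deriv v (\<lambda>x. - (l * x $ i / 2)) p = - (l * v $ i / 2)" for v :: "real^7" and i
    using dir_deriv_cmult [of "\<lambda>x. x $ i" p v "l/2"] dir_deriv_cmult [of "\<lambda>x. x $ i" p v "-l/2"]
    by simp_all
  have "\<forall>\<alpha> \<beta> k. dir_deriv (ebcv_frame m l p $ \<alpha>) (\<lambda>x. ebcv_frame m l x $ \<beta> $ k) p
    - dir_deriv (ebcv_frame m l p $ \<beta>) (\<lambda>x. ebcv_frame m l x $ \<alpha> $ k) p
    = (\<Sum>\<gamma>\<in>UNIV. ebcv_c m l \<gamma> \<alpha> \<beta> p * ebcv_frame m l p $ \<gamma> $ k)"
    by (simp add: forall_7 sum_7 ebcv_frame_def Let_def lin dir_deriv_K ebcv_c_def ebcv_F_def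
        ebcv_rad_def ebcv_twist_def ebcv_h_def hor_def axis_def algebra_simps)
  then show ?thesis
    by blast
qed

lemma ebcv_orthonormal_frame: "orthonormal_frame (ebcv_metric m l) (EBCV m) (ebcv_frame m l) (ebcv_c m l)"
proof
  show "open (EBCV m)"
    unfolding EBCV_def ebcv_K_def by (intro open_Collect_less continuous_intros)
  show "bilinear (ebcv_metric m l x)" if "x \<in> EBCV m" for x
    by (auto simp: bilinear_def linear_iff ebcv_metric_def ebcv_form_def Let_def algebra_simps
        add_divide_distrib diff_divide_distrib)
  show "ebcv_metric m l x u v = ebcv_metric m l x v u" for x u v
    by (simp add: ebcv_metric_def mult.commute)
  show "ebcv_metric m l x (ebcv_frame m l x $ \<alpha>) (ebcv_frame m l x $ \<beta>) = (if \<alpha> = \<beta> then 1 else 0)"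
    if "x \<in> EBCV m" for x \<alpha> \<beta>
    using that by (rule ebcv_frame_orthonormal)
  show "entries_differentiable (metric_coeff (ebcv_metric m l)) x" if "x \<in> EBCV m" for x
  proof -
    have "ebcv_K m x \<noteq> 0"
      using that by (simp add: EBCV_def)
    then show ?thesis
      unfolding entries_differentiable_def metric_coeff_def vec_lambda_beta ebcv_metric_def
        ebcv_form_def Let_def vector_3
      by (intro allI differentiable_add differentiable_diff differentiable_mult differentiable_divide
          differentiable_power differentiable_const differentiable_coord ebcv_differentiable(1)) auto
  qed
  have deriv: "matrix_deriv i (ebcv_frame m l) = (\<lambda>x. \<chi> \<alpha> k. partial_deriv i (\<lambda>x. ebcv_frame m l x $ \<alpha> $ k) x)"
    for i
    by (auto simp: matrix_deriv_def)
  show "entries_differentiable (ebcv_frame m l) x" for x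
    by (simp add: entries_differentiable_def differentiable_at_real_polynomial_function
        real_polynomial_frame)
  show "entries_differentiable (matrix_deriv i (ebcv_frame m l)) x" for x i
    by (simp add: deriv entries_differentiable_def differentiable_at_real_polynomial_function
        real_polynomial_partial_deriv [unfolded eta_contract_eq] real_polynomial_frame)
  show "matrix_deriv i (matrix_deriv j (ebcv_frame m l)) x = matrix_deriv j (matrix_deriv i (ebcv_frame m l)) x"
    for x i j
    using real_polynomial_partial_deriv_commute [OF real_polynomial_frame]
    by (simp add: deriv) (simp add: matrix_deriv_def)
  show "ebcv_c m l \<gamma> \<alpha> \<beta> differentiable at x" for x \<gamma> \<alpha> \<beta>
    by simp
  show "ebcv_c m l \<gamma> \<alpha> \<beta> x = - ebcv_c m l \<gamma> \<beta> \<alpha> x" for x \<gamma> \<alpha> \<beta>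
    by (simp add: ebcv_c_def ebcv_F_antisym [of m l \<gamma> \<alpha> \<beta>] algebra_simps)
  show "dir_deriv (ebcv_frame m l x $ \<alpha>) (\<lambda>x. ebcv_frame m l x $ \<beta> $ k) x
    - dir_deriv (ebcv_frame m l x $ \<beta>) (\<lambda>x. ebcv_frame m l x $ \<alpha> $ k) x
    = (\<Sum>\<gamma>\<in>UNIV. ebcv_c m l \<gamma> \<alpha> \<beta> x * ebcv_frame m l x $ \<gamma> $ k)" for x \<alpha> \<beta> k
    by (rule frame_bracket)
qed

lemma ebcv_h_sym: "ebcv_h \<alpha> \<beta> = ebcv_h \<beta> \<alpha>"
  by (auto simp: ebcv_h_def)

lemma ebcv_h_vert [simp]: "\<alpha> \<in> vert \<Longrightarrow> ebcv_h \<alpha> \<beta> = 0" "\<beta> \<in> vert \<Longrightarrow> ebcv_h \<alpha> \<beta> = 0"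
  by (auto simp: ebcv_h_def not_vert_and_hor)

lemma ebcv_h_hor [simp]: "\<alpha> \<in> hor \<Longrightarrow> ebcv_h \<alpha> \<beta> = (if \<alpha> = \<beta> then 1 else 0)"
  by (auto simp: ebcv_h_def)

lemma ebcv_twist_axis_vert [simp]: "i \<in> vert \<Longrightarrow> ebcv_twist (axis i 1) $ a $ j = 0"
  using ebcv_twist_axis_antisym [of i a j] by simp

section \<open>The Ricci tensor in terms of the curvature forms\<close>

lemma koszul_ebcv:
  "koszul (ebcv_c m l) \<gamma> \<alpha> \<beta> p =
     2 * m * (ebcv_h \<alpha> \<beta> * ebcv_rad p $ \<gamma> - ebcv_h \<alpha> \<gamma> * ebcv_rad p $ \<beta>)
     + (ebcv_F m l \<beta> \<alpha> \<gamma> p + ebcv_F m l \<alpha> \<beta> \<gamma> p - ebcv_F m l \<gamma> \<alpha> \<beta> p) / 2"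
  using ebcv_h_sym [of \<beta> \<gamma>] ebcv_h_sym [of \<beta> \<alpha>] ebcv_h_sym [of \<gamma> \<alpha>]
  by (simp add: koszul_def ebcv_c_def field_simps)

lemma frame_deriv_koszul:
  "dir_deriv (ebcv_frame m l p $ \<mu>) (koszul (ebcv_c m l) \<gamma> \<alpha> \<beta>) p =
     2 * m * ebcv_K m p * (ebcv_h \<alpha> \<beta> * ebcv_h \<mu> \<gamma> - ebcv_h \<alpha> \<gamma> * ebcv_h \<mu> \<beta>)
     + (dir_deriv (ebcv_frame m l p $ \<mu>) (ebcv_F m l \<beta> \<alpha> \<gamma>) p
        + dir_deriv (ebcv_frame m l p $ \<mu>) (ebcv_F m l \<alpha> \<beta> \<gamma>) p
        - dir_deriv (ebcv_frame m l p $ \<mu>) (ebcv_F m l \<gamma> \<alpha> \<beta>) p) / 2"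
  unfolding koszul_ebcv [abs_def]
  by (simp add: dir_deriv_add dir_deriv_diff dir_deriv_cmult dir_deriv_cdivide frame_deriv_rad)
    (simp add: algebra_simps)

lemma frame_deriv_F_zero [simp]:
  "a \<in> hor \<Longrightarrow> dir_deriv v (ebcv_F m l a i j) p = 0"
  "i \<in> vert \<Longrightarrow> dir_deriv v (ebcv_F m l a i j) p = 0"
  "j \<in> vert \<Longrightarrow> dir_deriv v (ebcv_F m l a i j) p = 0"
  "dir_deriv v (ebcv_F m l a i i) p = 0"
proof -
  have zero: "dir_deriv v f p = 0" if "f = (\<lambda>x. 0)" for f
    by (simp add: that)
  show "a \<in> hor \<Longrightarrow> dir_deriv v (ebcv_F m l a i j) p = 0"
    "i \<in> vert \<Longrightarrow> dir_deriv v (ebcv_F m l a i j) p = 0"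
    "j \<in> vert \<Longrightarrow> dir_deriv v (ebcv_F m l a i j) p = 0"
    "dir_deriv v (ebcv_F m l a i i) p = 0"
    by (rule zero; simp add: fun_eq_iff)+
qed

lemma frame_deriv_F_vert [simp]: "\<mu> \<in> vert \<Longrightarrow> dir_deriv (ebcv_frame m l p $ \<mu>) (ebcv_F m l a i j) p = 0"
  by (simp add: frame_deriv_F)

lemma trace_koszul_ebcv:
  "(\<Sum>\<gamma>\<in>UNIV. koszul (ebcv_c m l) \<gamma> \<gamma> \<delta> p) = - 6 * m * ebcv_rad p $ \<delta>"
proof (cases "\<delta> \<in> vert")
  case True
  then show ?thesis
    by (simp add: sum_vert_hor koszul_ebcv)
next
  case False
  then have "\<delta> \<in> hor"
    using vert_or_hor by blast
  then show ?thesis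
    by (auto dest!: hor_cases simp: sum_vert_hor sum_vert sum_hor koszul_ebcv)
qed

text \<open>The relation behind all cancellations between \<open>K\<close> and the coordinates.\<close>

lemma ebcv_K_rad:
  "ebcv_K m p = 1 + m * ((ebcv_rad p $ 4)\<^sup>2 + (ebcv_rad p $ 5)\<^sup>2 + (ebcv_rad p $ 6)\<^sup>2 + (ebcv_rad p $ 7)\<^sup>2)"
  by (simp add: ebcv_K_def ebcv_rad_def)

text \<open>
  Oriented so that the first base index becomes the smaller one: this identifies the terms of the finite
  sums without a looping rewrite rule.
\<close>

lemmas ebcv_F_swap = ebcv_F_antisym [of _ _ _ 5 4] ebcv_F_antisym [of _ _ _ 6 4]
  ebcv_F_antisym [of _ _ _ 7 4] ebcv_F_antisym [of _ _ _ 6 5] ebcv_F_antisym [of _ _ _ 7 5]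
  ebcv_F_antisym [of _ _ _ 7 6]

abbreviation (input) ebcv_ricci :: "real \<Rightarrow> real \<Rightarrow> real^7 \<Rightarrow> 7 \<Rightarrow> 7 \<Rightarrow> real" where
  "ebcv_ricci m l p \<alpha> \<beta> \<equiv>
    ricci (ebcv_metric m l) p (ebcv_frame m l p $ \<alpha>) (ebcv_frame m l p $ \<beta>)"

lemmas ebcv_ricci_frame = orthonormal_frame.ricci_frame [OF ebcv_orthonormal_frame]

text \<open>
  Of the terms in \<open>ricci_frame\<close> only the quadratic one remains: the connection has no coefficient with two
  fibre indices, and the \<open>X\<^sub>j\<close>-component of the derivative of \<open>X\<^sub>a\<close> along \<open>X\<^sub>i\<close> is \<open>F\<^sup>a\<^sub>i\<^sub>j / 2\<close>.
\<close>

lemma ricci_vert_vert: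
  assumes "p \<in> EBCV m" "\<beta> \<in> vert" "\<delta> \<in> vert"
  shows "ebcv_ricci m l p \<beta> \<delta>
    = 1/4 * (\<Sum>i\<in>hor. \<Sum>j\<in>hor. ebcv_F m l \<beta> i j p * ebcv_F m l \<delta> i j p)"
  unfolding ebcv_ricci_frame [OF assms(1)] using assms(2,3)
  by (simp add: frame_deriv_koszul trace_koszul_ebcv sum_vert_hor cong: sum.cong,
      simp add: koszul_ebcv cong: sum.cong,
      simp only: sum_hor ebcv_F_same ebcv_F_swap, algebra)

text \<open>
  Half the divergence of \<open>F\<^sup>a\<close> on the base.  The factor \<open>4 m\<close> collects the two places where the
  base connection enters: \<open>6 m\<close> comes from its trace, and \<open>2 m\<close> with the opposite sign from its product
  with \<open>F\<^sup>a\<close>.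
\<close>

lemma ricci_vert_hor:
  assumes "p \<in> EBCV m" "\<beta> \<in> vert" "\<delta> \<in> hor"
  shows "ebcv_ricci m l p \<beta> \<delta>
    = 1/2 * ((\<Sum>i\<in>hor. dir_deriv (ebcv_frame m l p $ i) (ebcv_F m l \<beta> \<delta> i) p)
             - 4 * m * (\<Sum>i\<in>hor. ebcv_rad p $ i * ebcv_F m l \<beta> \<delta> i p))" (is "_ = ?RHS")
    and "ebcv_ricci m l p \<delta> \<beta> = ebcv_ricci m l p \<beta> \<delta>"
proof -
  have "ebcv_ricci m l p \<beta> \<delta> = ?RHS"
    unfolding ebcv_ricci_frame [OF assms(1)] using assms(2,3)
    by (simp add: frame_deriv_koszul trace_koszul_ebcv sum_vert_hor cong: sum.cong,
        simp add: koszul_ebcv cong: sum.cong, elim hor_cases [elim_format] disjE)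
      (simp_all only: sum_hor ebcv_F_same ebcv_F_swap, simp_all, simp_all add: algebra_simps)
  moreover have "ebcv_ricci m l p \<delta> \<beta> = ?RHS"
    unfolding ebcv_ricci_frame [OF assms(1)] using assms(2,3)
    by (simp add: frame_deriv_koszul trace_koszul_ebcv sum_vert_hor cong: sum.cong,
        simp add: koszul_ebcv cong: sum.cong, elim hor_cases [elim_format] disjE)
      (simp_all only: sum_hor ebcv_F_same ebcv_F_swap, simp_all, simp_all add: algebra_simps)
  ultimately show "ebcv_ricci m l p \<beta> \<delta> = ?RHS" "ebcv_ricci m l p \<delta> \<beta> = ebcv_ricci m l p \<beta> \<delta>"
    by simp_all
qed

text \<open>
  The first term is the Ricci tensor of the base, which is four-dimensional of constant curvature
  \<open>4m\<close>.  The second is the loss of curvature along the base that O'Neill's formula predicts for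
  a Riemannian submersion.
\<close>

lemma ricci_hor_hor:
  assumes "p \<in> EBCV m" "\<beta> \<in> hor" "\<delta> \<in> hor"
  shows "ebcv_ricci m l p \<beta> \<delta> = 12 * m * (if \<beta> = \<delta> then 1 else 0)
    - 1/2 * (\<Sum>a\<in>vert. \<Sum>i\<in>hor. ebcv_F m l a \<beta> i p * ebcv_F m l a \<delta> i p)"
  unfolding ebcv_ricci_frame [OF assms(1)] using assms(2,3)
  by (simp add: frame_deriv_koszul trace_koszul_ebcv sum_vert_hor cong: sum.cong,
      simp add: koszul_ebcv cong: sum.cong, elim hor_cases [elim_format] disjE)
    (simp_all only: sum_hor sum_vert ebcv_F_same ebcv_F_swap, simp_all,
     simp_all add: ebcv_K_rad power2_eq_square algebra_simps, simp_all add: field_simps)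

section \<open>Evaluation of the curvature forms\<close>

text \<open>
  The remaining identities are polynomial in \<open>m\<close>, \<open>l\<close> and the position once \<open>K\<close> is expanded.  Behind
  them is the fact that for every quaternion \<open>q\<close> the vectors \<open>q\<close>, \<open>i q\<close>, \<open>j q\<close>, \<open>k q\<close> are orthogonal and of
  equal length.
\<close>

lemma ebcv_F_sum_vert_vert:
  "\<forall>\<beta>\<in>vert. \<forall>\<delta>\<in>vert. (\<Sum>i\<in>hor. \<Sum>j\<in>hor. ebcv_F m l \<beta> i j p * ebcv_F m l \<delta> i j p)
    = 2 * l\<^sup>2 * ((ebcv_K m p)\<^sup>2 + 1) * (if \<beta> = \<delta> then 1 else 0)"
  unfolding ball_vert sum_hor
  by (simp add: ebcv_F_def ebcv_twist_def axis_def, simp only: ebcv_K_rad [of m p], (intro conjI; algebra))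

lemma ebcv_F_sum_vert_hor:
  "\<forall>\<beta>\<in>vert. \<forall>\<delta>\<in>hor. (\<Sum>i\<in>hor. dir_deriv (ebcv_frame m l p $ i) (ebcv_F m l \<beta> \<delta> i) p)
     - 4 * m * (\<Sum>i\<in>hor. ebcv_rad p $ i * ebcv_F m l \<beta> \<delta> i p)
     = 2 * m * l * (ebcv_K m p + 2) * ebcv_twist (ebcv_rad p) $ \<beta> $ \<delta>"
  unfolding ball_vert ball_hor sum_hor frame_deriv_F
  by (simp add: ebcv_F_def ebcv_twist_def axis_def, simp only: ebcv_K_rad [of m p], (intro conjI; algebra))

lemma ebcv_F_sum_hor_hor:
  "\<forall>\<beta>\<in>hor. \<forall>\<delta>\<in>hor. (\<Sum>a\<in>vert. \<Sum>i\<in>hor. ebcv_F m l a \<beta> i p * ebcv_F m l a \<delta> i p)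
     = l\<^sup>2 * (3 + 2 * (ebcv_K m p + 1) * (ebcv_K m p - 1)) * (if \<beta> = \<delta> then 1 else 0)
    - 2 * m * l\<^sup>2 * (ebcv_K m p + 1) * ebcv_rad p $ \<beta> * ebcv_rad p $ \<delta>"
  unfolding ball_vert ball_hor sum_hor sum_vert
  by (simp add: ebcv_F_def ebcv_twist_def axis_def, simp only: ebcv_K_rad [of m p], (intro conjI; algebra))

lemma ricci_vert_vert_value:
  assumes "p \<in> EBCV m" "\<beta> \<in> vert" "\<delta> \<in> vert"
  shows "ebcv_ricci m l p \<beta> \<delta> = (if \<beta> = \<delta> then l\<^sup>2 / 2 * ((ebcv_K m p)\<^sup>2 + 1) else 0)"
  using assms ebcv_F_sum_vert_vert [of m l p] by (simp add: ricci_vert_vert)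

lemma ricci_vert_hor_value:
  assumes "p \<in> EBCV m" "\<beta> \<in> vert" "\<delta> \<in> hor"
  shows "ebcv_ricci m l p \<beta> \<delta> = m * l * (ebcv_K m p + 2) * ebcv_twist (ebcv_rad p) $ \<beta> $ \<delta>"
    and "ebcv_ricci m l p \<delta> \<beta> = m * l * (ebcv_K m p + 2) * ebcv_twist (ebcv_rad p) $ \<beta> $ \<delta>"
proof -
  show "ebcv_ricci m l p \<beta> \<delta> = m * l * (ebcv_K m p + 2) * ebcv_twist (ebcv_rad p) $ \<beta> $ \<delta>"
    unfolding ricci_vert_hor(1) [OF assms]
    using assms(2,3) ebcv_F_sum_vert_hor [of m l p] by simp
  then show "ebcv_ricci m l p \<delta> \<beta> = m * l * (ebcv_K m p + 2) * ebcv_twist (ebcv_rad p) $ \<beta> $ \<delta>"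
    by (simp only: ricci_vert_hor(2) [OF assms])
qed

lemma ricci_hor_hor_value:
  assumes "p \<in> EBCV m" "\<beta> \<in> hor" "\<delta> \<in> hor"
  shows "ebcv_ricci m l p \<beta> \<delta> =
    (if \<beta> = \<delta> then 12 * m - 3/2 * l\<^sup>2 - l\<^sup>2 * (ebcv_K m p + 1) * (ebcv_K m p - 1) else 0)
    + m * l\<^sup>2 * (ebcv_K m p + 1) * ebcv_rad p $ \<beta> * ebcv_rad p $ \<delta>"
  unfolding ricci_hor_hor [OF assms] ebcv_F_sum_hor_hor [rule_format, OF assms(2,3)]
  by (simp add: algebra_simps)

theorem proposition4:
  fixes m l :: real and p :: "real^7"
  assumes "p \<in> EBCV m"
  shows "(\<chi> \<alpha> \<beta>. ricci (ebcv_metric m l) p (ebcv_frame m l p $ \<alpha>) (ebcv_frame m l p $ \<beta>))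
    = block_matrix (ebcv_V m l p) (ebcv_M m l p) (transpose (ebcv_M m l p)) (ebcv_H m l p)"
  by (simp add: vec_eq_iff forall_7 ricci_vert_vert_value ricci_vert_hor_value ricci_hor_hor_value assms
      block_matrix_def ebcv_V_def mat_def ebcv_M_def ebcv_H_def transpose_def Let_def
      ebcv_twist_def ebcv_rad_def power2_eq_square algebra_simps)

end
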